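(* Let $\tau_0 \in [0,1]$ be arbitrary but fixed, and put $b := \frac{1}{1+\tau_0}\in[\frac12,1]$. Let $\mathcal{A}^\tau_{\tau_0}$ be the set of all Pickands dependence functions $A$ with $\tau(C_A)=\tau_0$. Then every $A \in \mathcal{A}^\tau_{\tau_0}$ satisfies $$L_{b}(t) \le A(t) \le U_{\tau_0}(t) \quad \text{for all } t \in [0,1].$$ Additionally, the set $$\Omega^\tau_{\tau_0} := \big\{(t,y) \in [0,1]\times[\tfrac12,1] : L_{b}(t) \le y \le U_{\tau_0}(t)\big\}$$ is best possible in the sense that for each point $(t,y) \in \Omega^\tau_{\tau_0}$ there exists some $A \in \mathcal{A}^\tau_{\tau_0}$ with $A(t)=y$.
   Context: A Pickands dependence function is a convex function $A:[0,1]\to[\frac12,1]$ with $\max\{t,1-t\}\le A(t)\le 1$ for all $t\in[0,1]$; $\mathcal{A}$ denotes the set of all of them. The extreme-value copula $C_A$ corresponding to $A\in\mathcal{A}$ is $$C_A(x,y)=(xy)^{A\left(\frac{\ln x}{\ln (xy)}\right)}, \qquad x,y\in(0,1),$$ extended to $[0,1]^2$ by continuity. Kendall's $\tau$ of a copula $C$ is $\tau(C)=-1+4\int_{[0,1]^2}C\,d\mu_C$, where $\mu_C$ is the probability measure on $[0,1]^2$ with distribution function $C$; for $C=C_A$ it is given by $$\tau(C_A)=1-\int_0^1\left(1+(1-t)\frac{A'(t)}{A(t)}\right)\left(1-t\,\frac{A'(t)}{A(t)}\right)d\lambda(t)=\int_{[0,1]}\frac{t(1-t)}{A(t)}\,dA'(t),$$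 where $\lambda$ is Lebesgue measure, $A'$ is the (almost everywhere defined) derivative of $A$, and the last integral is a Stieltjes integral. For $y\in[\frac12,1]$ the function $L_y\in\mathcal{A}$ is defined by $$L_y(t)=\begin{cases}1-t & \text{if } t\in[0,1-y],\\ y & \text{if } t\in(1-y,y],\\ t & \text{if } t\in(y,1].\end{cases}$$ For $\tau_0\in[0,1]$ the function $U_{\tau_0}\in\mathcal{A}$ is the piecewise linear function with $U_{\tau_0}(0)=U_{\tau_0}(1)=1$ and $U_{\tau_0}(\frac12)=1-\frac{\tau_0}{2}$, i.e. $$U_{\tau_0}(t)=\begin{cases}1-\tau_0 t & \text{if } t\in[0,\frac12],\\ 1-\tau_0(1-t) & \text{if } t\in(\frac12,1].\end{cases}$$ *)

theory Defs
  imports "HOL-Probability.Probability"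
begin

(* The lower bound max t (1 - t) forces A to map [0,1] into [1/2,1].
   Values of A outside [0,1] are irrelevant and left unconstrained. *)
definition pickands :: "(real \<Rightarrow> real) \<Rightarrow> bool" where
  "pickands A \<longleftrightarrow> convex_on {0..1} A \<and> (\<forall>t\<in>{0..1}. max t (1 - t) \<le> A t \<and> A t \<le> 1)"

(* The boundary values are the continuous extension from the open unit square;
   see continuous_on_ev_copula below.  Only the values on the closed unit square matter. *)
definition ev_copula :: "(real \<Rightarrow> real) \<Rightarrow> real \<Rightarrow> real \<Rightarrow> real" where
  "ev_copula A x y =
     (if x = 0 \<or> y = 0 then 0
      else if x = 1 then y
      else if y = 1 then x
      else (x * y) powr A (ln x / ln (x * y)))"

(* The probability measure on [0,1] x [0,1] with distribution function C, unique if it exists. *)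
definition copula_measure :: "(real \<Rightarrow> real \<Rightarrow> real) \<Rightarrow> (real \<times> real) measure" where
  "copula_measure C =
     (THE M. prob_space M \<and> sets M = sets (restrict_space borel ({0..1} \<times> {0..1})) \<and>
             (\<forall>x\<in>{0..1}. \<forall>y\<in>{0..1}. measure M ({0..x} \<times> {0..y}) = C x y))"

definition kendall_tau :: "(real \<Rightarrow> real \<Rightarrow> real) \<Rightarrow> real" where
  "kendall_tau C = - 1 + 4 * (LINT p|copula_measure C. C (fst p) (snd p))"

definition pickands_tau :: "real \<Rightarrow> (real \<Rightarrow> real) set" where
  "pickands_tau \<tau>0 = {A. pickands A \<and> kendall_tau (ev_copula A) = \<tau>0}"

definition lower_L :: "real \<Rightarrow> real \<Rightarrow> real" where
  "lower_L y t = (if t \<le> 1 - y then 1 - t else if t \<le> y then y else t)"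

definition upper_U :: "real \<Rightarrow> real \<Rightarrow> real" where
  "upper_U \<tau>0 t = (if t \<le> 1 / 2 then 1 - \<tau>0 * t else 1 - \<tau>0 * (1 - t))"

definition Omega_tau :: "real \<Rightarrow> (real \<times> real) set" where
  "Omega_tau \<tau>0 = {(t, y). t \<in> {0..1} \<and> y \<in> {1/2..1} \<and>
                      lower_L (1 / (1 + \<tau>0)) t \<le> y \<and> y \<le> upper_U \<tau>0 t}"

lemma ev_copula_arg:
  fixes x y :: real
  assumes "0 < x" "x < 1" "0 < y" "y < 1"
  shows "ln x / ln (x * y) \<in> {0<..<1}" "1 - ln x / ln (x * y) = ln y / ln (x * y)" "ln (x * y) < 0"
proof -
  have l: "ln (x * y) = ln x + ln y" "ln x < 0" "ln y < 0"
    using assms by (auto simp: ln_mult)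
  show "ln (x * y) < 0" using l by linarith
  show "ln x / ln (x * y) \<in> {0<..<1}" "1 - ln x / ln (x * y) = ln y / ln (x * y)"
    using l by (auto simp: field_simps)
qed

lemma ev_copula_bounds:
  assumes A: "pickands A" and "x \<in> {0..1}" "y \<in> {0..1}"
  shows "x * y \<le> ev_copula A x y" "ev_copula A x y \<le> min x y"
proof -
  have "x * y \<le> ev_copula A x y \<and> ev_copula A x y \<le> min x y"
  proof (cases "x \<in> {0<..<1} \<and> y \<in> {0<..<1}")
    case True
    define s where "s = ln x / ln (x * y)"
    define l where "l = ln (x * y)"
    have s: "s \<in> {0<..<1}" "1 - s = ln y / l" and l: "l < 0"
      using ev_copula_arg[of x y] True by (auto simp: s_def l_def)
    have As: "s \<le> A s" "1 - s \<le> A s" "A s \<le> 1"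
      using A s(1) by (auto simp: pickands_def)
    have C: "ev_copula A x y = exp (A s * l)"
      using True by (simp add: ev_copula_def powr_def s_def l_def)
    have "A s * l \<ge> 1 * l" "A s * l \<le> s * l" "A s * l \<le> (1 - s) * l"
      using As l by (auto intro!: mult_right_mono_neg)
    moreover have "s * l = ln x" "(1 - s) * l = ln y"
      using l s(2) by (auto simp: s_def l_def[symmetric])
    ultimately have "l \<le> A s * l" "A s * l \<le> ln x" "A s * l \<le> ln y" by auto
    hence "exp l \<le> exp (A s * l)" "exp (A s * l) \<le> exp (ln x)" "exp (A s * l) \<le> exp (ln y)" by auto
    moreover have "exp l = x * y" "exp (ln x) = x" "exp (ln y) = y"
      using True by (simp_all add: l_def)
    ultimately show ?thesis unfolding C by simp
  next
    case False
    thus ?thesis using assms(2,3) by (auto simp: ev_copula_def)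
  qed
  thus "x * y \<le> ev_copula A x y" "ev_copula A x y \<le> min x y" by auto
qed

lemma continuous_on_ev_copula:
  assumes A: "pickands A"
  shows "continuous_on ({0..1} \<times> {0..1}) (\<lambda>p. ev_copula A (fst p) (snd p))"
  unfolding continuous_on_def
proof
  let ?Q = "{0..1} \<times> {0..1} :: (real \<times> real) set"
  let ?I = "{0<..<1} \<times> {0<..<1} :: (real \<times> real) set"
  let ?f = "\<lambda>p. ev_copula A (fst p) (snd p)"
  fix p :: "real \<times> real" assume p: "p \<in> ?Q"
  show "(?f \<longlongrightarrow> ?f p) (at p within ?Q)"
  proof (cases "p \<in> ?I")
    case True
    have contA: "continuous_on {0<..<1} A"
    proof (rule convex_on_continuous)
      show "convex_on {0<..<1} A"
        by (rule convex_on_subset[of "{0..1}"]) (use A in \<open>auto simp: pickands_def\<close>)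
    qed auto
    have "continuous_on ?I (\<lambda>p. A (ln (fst p) / ln (fst p * snd p)))"
      by (rule continuous_on_compose2[OF contA])
         (use ev_copula_arg in \<open>force intro!: continuous_intros\<close>)+
    hence "continuous_on ?I (\<lambda>p. (fst p * snd p) powr A (ln (fst p) / ln (fst p * snd p)))"
      by (intro continuous_intros) auto
    hence "continuous_on ?I ?f"
      by (rule continuous_on_eq) (auto simp: ev_copula_def)
    moreover have "open ?I" by (intro open_Times) auto
    ultimately have "isCont ?f p" using True continuous_on_eq_continuous_at by blast
    thus ?thesis unfolding isCont_def by (rule tendsto_mono[rotated]) (simp add: at_le)
  next
    case False
    have ev: "\<forall>\<^sub>F q in at p within ?Q. q \<in> ?Q" by (simp add: eventually_at_filter)
    have edge: "fst p * snd p = ?f p" "min (fst p) (snd p) = ?f p"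
      using False p by (auto simp: ev_copula_def mem_Times_iff)
    show ?thesis
    proof (rule tendsto_sandwich)
      show "\<forall>\<^sub>F q in at p within ?Q. fst q * snd q \<le> ?f q"
        using ev by eventually_elim (auto intro: ev_copula_bounds[OF A])
      show "\<forall>\<^sub>F q in at p within ?Q. ?f q \<le> min (fst q) (snd q)"
        using ev by eventually_elim (use ev_copula_bounds(2)[OF A] in \<open>auto simp: mem_Times_iff\<close>)
      show "((\<lambda>q. fst q * snd q) \<longlongrightarrow> ?f p) (at p within ?Q)"
        unfolding edge(1)[symmetric] by (intro tendsto_intros)
      show "((\<lambda>q. min (fst q) (snd q)) \<longlongrightarrow> ?f p) (at p within ?Q)"
        unfolding edge(2)[symmetric] by (intro tendsto_intros)
    qed
  qed
qed

end

theory Submission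
  imports Defs
begin

text \<open>
  Write \<open>P s\<close> and \<open>Q s\<close> for the heights over \<open>1\<close> and over \<open>0\<close> of the tangent of \<open>A\<close> at \<open>s\<close>. The
  whole argument rests on the formula that \<open>1 - \<tau>\<close> is the integral of \<open>P Q / A\<^sup>2\<close> over the
  unit interval, together with two observations: \<open>P / A\<^sup>2\<close> is the derivative of \<open>- (1 - s) / A s\<close>
  and \<open>Q / A\<^sup>2\<close> is the derivative of \<open>s / A s\<close>; and \<open>P\<close> increases, \<open>Q\<close> decreases, and both stay
  between \<open>0\<close> and \<open>1\<close>.

  Split the integral at a point \<open>u\<close>. Estimating \<open>Q\<close> by \<open>1\<close> left of \<open>u\<close> and \<open>P\<close> by \<open>1\<close> right of \<open>u\<close> gives
  \<open>1 - \<tau> \<le> 2 - 1 / A u\<close>, which is the lower bound \<open>A u \<ge> 1 / (1 + \<tau>)\<close>. Splitting at \<open>1/2\<close> and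
  estimating \<open>Q\<close> and \<open>P\<close> from below by their values at \<open>1/2\<close>, whose sum is \<open>2 * A (1/2)\<close>, gives
  \<open>1 - \<tau> \<ge> 2 * A (1/2) - 1\<close>; convexity extends this bound at the midpoint to all arguments.
  The first estimate, with \<open>u\<close> at the apex, is an equality for tents, so a tent has the prescribed
  \<open>\<tau>\<close> exactly when its apex is at height \<open>b\<close>, and each point of the region lies on such a tent.

  For the formula, the measure of the copula \<open>C\<close> is realised as the law of \<open>(x, y)\<close> where \<open>x\<close> is uniform
  and \<open>y\<close> is the conditional quantile, given \<open>x\<close>, of a second independent uniform variable. On
  the line over \<open>x\<close> the coordinate \<open>s = ln x / ln (x y)\<close> is used instead of \<open>y\<close>. There \<open>C\<close> equals
  \<open>x powr (A s / s)\<close> and the conditional distribution function is \<open>x powr (A s / s - 1) * P s\<close>. Writing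
  \<open>C\<close> as the integral of its derivative in \<open>s\<close> and exchanging integrals leaves an elementary integral
  in \<open>x\<close>, which produces \<open>P Q / (4 * A\<^sup>2)\<close>.

  The main results on the way are \<open>copula_measure_ev_copula\<close>, \<open>kendall_tau_ev_copula\<close>,
  \<open>kendall_tau_ge_value\<close>, \<open>kendall_tau_le_value_half\<close> and \<open>kendall_tau_tent\<close>.
\<close>

section \<open>The fundamental theorem of calculus with countably many exceptions\<close>

text \<open>
  A point can be the tag of at most two nondegenerate intervals of a division, one reaching beyond it
  to the right and one ending at it. Hence the intervals tagged by an exceptional point of a
  countable set contribute to a Riemann sum at most twice the error admitted at that point, which
  makes the total error summable.
\<close>

lemma tags_of_nondegenerate_intervals_inj:
  fixes p :: "(real \<times> real set) set"
  assumes "p tagged_division_of {a..b}"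
  shows "inj_on (\<lambda>(x, K). (x, x < Sup K)) {(x, K). (x, K) \<in> p \<and> Inf K < Sup K}"
proof (rule inj_onI, clarsimp)
  fix x K K' assume K: "(x, K) \<in> p" "Inf K < Sup K" and K': "(x, K') \<in> p" "Inf K' < Sup K'"
    and eq: "(x < Sup K) = (x < Sup K')"
  obtain u v where uv: "K = {u..v}" "x \<in> K" using tagged_division_ofD[OF assms] K by (metis box_real(2))
  obtain u' v' where uv': "K' = {u'..v'}" "x \<in> K'" using tagged_division_ofD[OF assms] K' by (metis box_real(2))
  have le: "u < v" "u' < v'" using K(2) K'(2) uv uv' by auto
  define z where "z = (if x < v then (x + min v v') / 2 else (x + max u u') / 2)"
  have "z \<in> {u<..<v}" "z \<in> {u'<..<v'}"
    using eq uv uv' le unfolding z_def by (auto simp: field_simps min_def max_def split: if_splits)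
  hence "interior K \<inter> interior K' \<noteq> {}" using uv uv' by (auto simp: interior_atLeastAtMost_real)
  thus "K = K'" using tagged_division_ofD(5)[OF assms K(1) K'(1)] by auto
qed

text \<open>
  A dependence function may have infinitely many kinks, so a finite exceptional set does not suffice
  here. Setting the integrand to zero at the exceptional points leaves the integral unchanged;
  at the \<open>n\<close>-th such point continuity of \<open>f\<close> gives a gauge that forces the increment of \<open>f\<close> below
  a multiple of \<open>2\<close> to the power \<open>-n\<close>, and elsewhere the usual straddle estimate applies.
\<close>

lemma fundamental_theorem_of_calculus_countable:
  fixes f g :: "real \<Rightarrow> real"
  assumes "a \<le> b" and N: "countable N" and cont: "continuous_on {a..b} f"
    and deriv: "\<And>x. a < x \<Longrightarrow> x < b \<Longrightarrow> x \<notin> N \<Longrightarrow> (f has_real_derivative g x) (at x)"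
  shows "(g has_integral (f b - f a)) {a..b}"
proof -
  define E where "E = N \<union> {a, b}"
  define h where "h x = (if x \<in> E then 0 else g x)" for x
  have E: "countable E" using N by (simp add: E_def)
  have inj: "inj_on (to_nat_on E) E" by (rule inj_on_to_nat_on[OF E])
  have "(h has_integral (f b - f a)) (cbox a b)"
    unfolding has_integral
  proof (intro allI impI)
    fix e :: real assume e: "e > 0"
    \<comment> \<open>Half of the error \<open>e\<close> goes to the regular points; the exceptional points cause at most
      \<open>8 * e2\<close>: a factor \<open>2\<close> from the two halves of an interval around its tag, \<open>2\<close> from the two
      intervals sharing a tag, and \<open>2\<close> from the geometric series.\<close>
    define e1 where "e1 = e / (2 * (b - a + 1))"
    define e2 where "e2 = e / 16"
    have e1: "e1 > 0" "e1 * (b - a) < e / 2" and e2: "e2 > 0"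
      using e assms(1) by (auto simp: e1_def e2_def field_simps)
    define c where "c x = e2 * (1/2) ^ to_nat_on E x" for x
    have c: "c x > 0" for x using e2 by (simp add: c_def)
    have "\<exists>d>0. x \<in> {a..b} \<longrightarrow>
         (\<forall>y\<in>{a..b}. \<bar>y - x\<bar> < d \<longrightarrow> \<bar>f y - f x - (y - x) * h x\<bar> \<le> (if x \<in> E then c x else e1 * \<bar>y - x\<bar>))" for x
    proof (cases "x \<in> {a..b}")
      case x: True
      show ?thesis
      proof (cases "x \<in> E")
        case True
        from continuous_onE[OF cont x c[of x]] obtain d where "d > 0"
          "\<And>y. y \<in> {a..b} \<Longrightarrow> dist y x < d \<Longrightarrow> dist (f y) (f x) \<le> c x"
          by (metis less_imp_le)
        thus ?thesis using True by (intro exI[of _ d]) (auto simp: h_def dist_real_def)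
      next
        case False
        hence "(f has_real_derivative g x) (at x)" using deriv x by (auto simp: E_def)
        hence "(f has_derivative (\<lambda>y. g x * y)) (at x)" by (simp add: has_field_derivative_def)
        from this[unfolded has_derivative_at_alt] e1(1) obtain d where "d > 0"
          "\<And>y. norm (y - x) < d \<Longrightarrow> norm (f y - f x - g x * (y - x)) \<le> e1 * norm (y - x)" by blast
        thus ?thesis using False by (intro exI[of _ d]) (auto simp: h_def mult.commute)
      qed
    qed (auto intro: exI[of _ 1])
    then obtain d where d: "\<And>x. d x > 0"
      "\<And>x y. x \<in> {a..b} \<Longrightarrow> y \<in> {a..b} \<Longrightarrow> \<bar>y - x\<bar> < d x \<Longrightarrow>
         \<bar>f y - f x - (y - x) * h x\<bar> \<le> (if x \<in> E then c x else e1 * \<bar>y - x\<bar>)"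
      by metis
    show "\<exists>\<gamma>. gauge \<gamma> \<and> (\<forall>p. p tagged_division_of cbox a b \<and> \<gamma> fine p \<longrightarrow>
        norm ((\<Sum>(x, k)\<in>p. measure lborel k *\<^sub>R h x) - (f b - f a)) < e)"
    proof (intro exI conjI allI impI)
      show "gauge (\<lambda>x. ball x (d x))" using d(1) gauge_ball_dependent by blast
      fix p assume p': "p tagged_division_of cbox a b \<and> (\<lambda>x. ball x (d x)) fine p"
      hence p: "p tagged_division_of {a..b}" and fine: "(\<lambda>x. ball x (d x)) fine p" by auto
      have fin: "finite p" using p by blast
      define q where "q = {(x, K). (x, K) \<in> p \<and> Inf K < Sup K}"
      have qp: "q \<subseteq> p" by (auto simp: q_def)
      have finq: "finite q" using qp fin finite_subset by blast
      have bound: "\<bar>measure lborel K * h x - (f (Sup K) - f (Inf K))\<bar>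
          \<le> e1 * (Sup K - Inf K) + (if (x, K) \<in> q \<and> x \<in> E then 2 * c x else 0)" if xK: "(x, K) \<in> p" for x K
      proof -
        obtain u v where uv: "K = {u..v}" "x \<in> K" "K \<subseteq> {a..b}"
          using tagged_division_ofD[OF p] xK by (metis box_real(2))
        have le: "u \<le> x" "x \<le> v" "a \<le> u" "v \<le> b" using uv by auto
        have "K \<subseteq> ball x (d x)" using fine xK by (auto simp: fine_def)
        moreover have "u \<in> K" "v \<in> K" using uv le by auto
        ultimately have "u \<in> ball x (d x)" "v \<in> ball x (d x)" by blast+
        hence b: "\<bar>f u - f x - (u - x) * h x\<bar> \<le> (if x \<in> E then c x else e1 * \<bar>u - x\<bar>)"
           "\<bar>f v - f x - (v - x) * h x\<bar> \<le> (if x \<in> E then c x else e1 * \<bar>v - x\<bar>)"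
          using d(2)[of x u] d(2)[of x v] le by (auto simp: dist_real_def abs_minus_commute)
        have S: "Sup K = v" "Inf K = u" "measure lborel K = v - u" using uv le by auto
        have t: "\<bar>measure lborel K * h x - (f v - f u)\<bar> \<le>
           \<bar>f u - f x - (u - x) * h x\<bar> + \<bar>f v - f x - (v - x) * h x\<bar>"
          unfolding S by (simp add: algebra_simps)
        show ?thesis
        proof (cases "u = v")
          case True
          thus ?thesis unfolding S using e1 by (auto simp: q_def S c less_imp_le)
        next
          case False
          hence "(x, K) \<in> q" using xK S le by (auto simp: q_def)
          moreover have "e1 * (v - u) = e1 * \<bar>u - x\<bar> + e1 * \<bar>v - x\<bar>"
            using le by (simp add: algebra_simps)
          moreover have "e1 * (v - u) \<ge> 0" using e1 le by simp
          ultimately show ?thesis using t b unfolding S by (cases "x \<in> E") simp_all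
        qed
      qed
      have "(\<Sum>n\<le>m. (1/2::real) ^ n) = 2 - (1/2) ^ m" for m :: nat
        by (induction m) auto
      hence geometric: "(\<Sum>n\<le>m. (1/2::real) ^ n) \<le> 2" for m :: nat
        by simp
      have "(\<Sum>(x, K)\<in>{r\<in>q. fst r \<in> E}. c x) \<le> 4 * e2"
      proof -
        let ?q = "{r\<in>q. fst r \<in> E}"
        let ?j = "\<lambda>(x, K). (to_nat_on E x, x < Sup K)"
        have "inj_on ?j ?q"
          using tags_of_nondegenerate_intervals_inj[OF p, folded q_def] inj
          unfolding inj_on_def by (simp add: case_prod_unfold)
        hence "(\<Sum>(x, K)\<in>?q. c x) = (\<Sum>(n, _)\<in>?j ` ?q. e2 * (1/2) ^ n)"
          by (subst sum.reindex) (auto simp: c_def case_prod_unfold)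
        also have "\<dots> \<le> (\<Sum>(n, _)\<in>{..Max (fst ` (?j ` ?q))} \<times> (UNIV :: bool set). e2 * (1/2) ^ n)"
        proof (rule sum_mono2)
          show "?j ` ?q \<subseteq> {..Max (fst ` (?j ` ?q))} \<times> UNIV"
          proof
            fix r assume r: "r \<in> ?j ` ?q"
            have "fst r \<le> Max (fst ` (?j ` ?q))" by (rule Max_ge) (use finq r in auto)
            thus "r \<in> {..Max (fst ` (?j ` ?q))} \<times> UNIV" by (cases r) auto
          qed
        qed (use e2 in auto)
        also have "\<dots> = (\<Sum>n\<le>Max (fst ` (?j ` ?q)). 2 * e2 * (1/2) ^ n)"
          by (simp add: sum.cartesian_product[symmetric] mult.assoc)
        also have "\<dots> = 2 * e2 * (\<Sum>n\<le>Max (fst ` (?j ` ?q)). (1/2) ^ n)"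
          by (simp only: sum_distrib_left)
        also have "\<dots> \<le> 2 * e2 * 2"
          using e2 by (intro mult_left_mono geometric) auto
        finally show ?thesis by simp
      qed
      hence "(\<Sum>(x, K)\<in>{r\<in>q. fst r \<in> E}. 2 * c x) \<le> 8 * e2"
        by (simp add: case_prod_unfold flip: sum_distrib_left)
      moreover have "(\<Sum>(x, K)\<in>p. if (x, K) \<in> q \<and> x \<in> E then 2 * c x else 0) =
          (\<Sum>(x, K)\<in>{r\<in>q. fst r \<in> E}. 2 * c x)"
        using qp fin by (intro sum.mono_neutral_cong_right) (auto split: if_splits)
      moreover have "(\<Sum>(x, K)\<in>p. e1 * (Sup K - Inf K)) = e1 * (b - a)"
        using additive_tagged_division_1[OF assms(1) p, of "\<lambda>x. x"]
        by (simp add: case_prod_unfold flip: sum_distrib_left)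
      moreover have "(\<Sum>(x, K)\<in>p. measure lborel K * h x) - (f b - f a) =
          (\<Sum>(x, K)\<in>p. measure lborel K * h x - (f (Sup K) - f (Inf K)))"
        using additive_tagged_division_1[OF assms(1) p, of f] by (simp add: case_prod_unfold sum_subtractf)
      moreover have "\<bar>\<Sum>(x, K)\<in>p. measure lborel K * h x - (f (Sup K) - f (Inf K))\<bar>
          \<le> (\<Sum>(x, K)\<in>p. e1 * (Sup K - Inf K) + (if (x, K) \<in> q \<and> x \<in> E then 2 * c x else 0))"
        by (rule order_trans[OF sum_abs]) (auto intro!: sum_mono bound)
      ultimately have "\<bar>(\<Sum>(x, K)\<in>p. measure lborel K * h x) - (f b - f a)\<bar> \<le> e1 * (b - a) + 8 * e2"
        by (simp add: case_prod_unfold sum.distrib)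
      thus "norm ((\<Sum>(x, k)\<in>p. measure lborel k *\<^sub>R h x) - (f b - f a)) < e"
        using e1(2) by (simp add: e2_def)
    qed
  qed
  hence "(h has_integral (f b - f a)) {a..b}" by simp
  moreover have "negligible E"
    using countable_imp_null_set_lborel[OF E] null_sets_completionI
    by (auto simp: negligible_iff_null_sets)
  ultimately show ?thesis
    by (intro has_integral_spike[of E "{a..b}" g h]) (auto simp: h_def)
qed

section \<open>Tangents of Pickands dependence functions\<close>

text \<open>
  This is the right derivative of a convex function. Among the versions of the almost everywhere
  defined derivative the right-continuous one is chosen because the distribution functions built from
  it must be right-continuous.
\<close>

definition right_slope :: "(real \<Rightarrow> real) \<Rightarrow> real \<Rightarrow> real" where
  "right_slope A s = (INF t\<in>{s<..} \<inter> {0..1}. (A s - A t) / (s - t))"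

text \<open>
  The heights at which the tangent of \<open>A\<close> at \<open>s\<close> passes through the vertical lines over \<open>0\<close> and
  \<open>1\<close>. They carry all derivative information that is needed: the partial derivatives of the
  copula \<open>C\<close> in \<open>y\<close> and \<open>x\<close> are \<open>C/y\<close> times the first and \<open>C/x\<close> times the second height, at the
  argument \<open>s = ln x / ln (x y)\<close>.
\<close>

definition tangent_at_0 :: "(real \<Rightarrow> real) \<Rightarrow> real \<Rightarrow> real" where
  "tangent_at_0 A s = A s - s * right_slope A s"

definition tangent_at_1 :: "(real \<Rightarrow> real) \<Rightarrow> real \<Rightarrow> real" where
  "tangent_at_1 A s = A s + (1 - s) * right_slope A s"

lemma pickands_bounds:
  assumes "pickands A" "s \<in> {0..1}"
  shows "s \<le> A s" "1 - s \<le> A s" "A s \<le> 1"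
  using assms by (auto simp: pickands_def)

lemma pickands_pos: "pickands A \<Longrightarrow> s \<in> {0..1} \<Longrightarrow> 0 < A s"
  using pickands_bounds[of A s] by linarith

lemma pickands_ends:
  assumes "pickands A"
  shows "A 0 = 1" "A 1 = 1"
  using pickands_bounds[OF assms, of 0] pickands_bounds[OF assms, of 1] by auto

lemma right_slope_subgradient:
  assumes "pickands A" "s \<in> {0<..<1}" "t \<in> {0..1}"
  shows "A s + right_slope A s * (t - s) \<le> A t"
  using convex_le_Inf_differential[of "{0..1}" A s t] assms
  by (auto simp: pickands_def right_slope_def interior_atLeastAtMost_real)

lemma right_slope_mono:
  assumes A: "pickands A" and "s \<in> {0<..<1}" "t \<in> {0<..<1}" "s \<le> t"
  shows "right_slope A s \<le> right_slope A t"
proof (cases "s = t")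
  case False
  have "right_slope A s * (t - s) \<le> right_slope A t * (t - s)"
    using right_slope_subgradient[OF A, of s t] right_slope_subgradient[OF A, of t s] assms
    by (simp add: algebra_simps)
  thus ?thesis using False assms by simp
qed simp

lemma right_slope_mono_on: "pickands A \<Longrightarrow> mono_on {0<..<1} (right_slope A)"
  by (intro mono_onI right_slope_mono)

lemma right_slope_bounds:
  assumes A: "pickands A" and s: "s \<in> {0<..<1}"
  shows "- 1 \<le> right_slope A s" "right_slope A s \<le> 1"
proof -
  have "s * (- 1) \<le> s * right_slope A s"
    using right_slope_subgradient[OF A s, of 0] pickands_ends[OF A] pickands_bounds[OF A, of s] s
    by (simp add: algebra_simps)
  thus "- 1 \<le> right_slope A s" using s by (simp only: mult_le_cancel_left_pos greaterThanLessThan_iff)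
  have "(1 - s) * right_slope A s \<le> (1 - s) * 1"
    using right_slope_subgradient[OF A s, of 1] pickands_ends[OF A] pickands_bounds[OF A, of s] s
    by (simp add: algebra_simps)
  thus "right_slope A s \<le> 1" using s by simp
qed

lemma tangent_at_0_bounds:
  assumes A: "pickands A" and s: "s \<in> {0<..<1}"
  shows "0 \<le> tangent_at_0 A s" "tangent_at_0 A s \<le> 1"
proof -
  have "s * right_slope A s \<le> s * 1"
    using right_slope_bounds(2)[OF A s] s by (intro mult_left_mono) auto
  moreover have "s \<le> A s" using pickands_bounds[OF A, of s] s by simp
  moreover have "A s - s * right_slope A s \<le> 1"
    using right_slope_subgradient[OF A s, of 0] pickands_ends[OF A] by (simp add: algebra_simps)
  ultimately show "0 \<le> tangent_at_0 A s" "tangent_at_0 A s \<le> 1"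
    unfolding tangent_at_0_def by linarith+
qed

lemma tangent_at_1_bounds:
  assumes A: "pickands A" and s: "s \<in> {0<..<1}"
  shows "0 \<le> tangent_at_1 A s" "tangent_at_1 A s \<le> 1"
proof -
  have "(1 - s) * - 1 \<le> (1 - s) * right_slope A s"
    using right_slope_bounds(1)[OF A s] s by (intro mult_left_mono) auto
  thus "0 \<le> tangent_at_1 A s" "tangent_at_1 A s \<le> 1"
    using right_slope_subgradient[OF A s, of 1] pickands_ends[OF A] pickands_bounds[OF A, of s] s
    by (auto simp: tangent_at_1_def algebra_simps)
qed

text \<open>
  When the point of contact moves right, the tangent of a convex function turns counterclockwise, so
  its left end sinks and its right end rises.
\<close>

lemma tangent_at_0_antimono:
  assumes A: "pickands A" and st: "s \<in> {0<..<1}" "t \<in> {0<..<1}" "s \<le> t"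
  shows "tangent_at_0 A t \<le> tangent_at_0 A s"
proof -
  have "A t + right_slope A t * (s - t) \<le> A s" using right_slope_subgradient[OF A, of t s] st by simp
  moreover have "s * right_slope A s \<le> s * right_slope A t"
    using right_slope_mono[OF A st] st by (intro mult_left_mono) auto
  ultimately show ?thesis by (simp add: tangent_at_0_def algebra_simps)
qed

lemma tangent_at_1_mono:
  assumes A: "pickands A" and st: "s \<in> {0<..<1}" "t \<in> {0<..<1}" "s \<le> t"
  shows "tangent_at_1 A s \<le> tangent_at_1 A t"
proof -
  have "A s + right_slope A s * (t - s) \<le> A t" using right_slope_subgradient[OF A, of s t] st by simp
  moreover have "(1 - t) * right_slope A s \<le> (1 - t) * right_slope A t"
    using right_slope_mono[OF A st] st by (intro mult_left_mono) auto
  ultimately show ?thesis by (simp add: tangent_at_1_def algebra_simps)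
qed

lemma pickands_isCont:
  assumes A: "pickands A" and s: "s \<in> {0<..<1}"
  shows "isCont A s"
proof -
  have "continuous_on {0<..<1} A"
  proof (rule convex_on_continuous)
    show "convex_on {0<..<1} A"
      by (rule convex_on_subset[of "{0..1}"]) (use A in \<open>auto simp: pickands_def\<close>)
  qed auto
  thus ?thesis using s by (simp add: continuous_on_eq_continuous_at)
qed

lemma pickands_continuous_on:
  assumes A: "pickands A"
  shows "continuous_on {0..1} A"
  unfolding continuous_on_def
proof
  fix s :: real assume s: "s \<in> {0..1}"
  have ev: "\<forall>\<^sub>F t in at s within {0..1}. t \<in> {0..1}" by (simp add: eventually_at_filter)
  show "(A \<longlongrightarrow> A s) (at s within {0..1})"
  proof (cases "s \<in> {0<..<1}")
    case True
    show ?thesis using pickands_isCont[OF A True]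
      by (simp add: continuous_at_imp_continuous_at_within flip: continuous_within)
  next
    case False
    show ?thesis
    proof (rule tendsto_sandwich)
      show "\<forall>\<^sub>F t in at s within {0..1}. max t (1 - t) \<le> A t"
        using ev by eventually_elim (use pickands_bounds[OF A] in auto)
      show "\<forall>\<^sub>F t in at s within {0..1}. A t \<le> 1"
        using ev by eventually_elim (use pickands_bounds[OF A] in auto)
      have "A s = max s (1 - s)" "A s = 1" using False s pickands_ends[OF A] by auto
      thus "((\<lambda>t. max t (1 - t)) \<longlongrightarrow> A s) (at s within {0..1})" "((\<lambda>t. 1) \<longlongrightarrow> A s) (at s within {0..1})"
        by (auto intro!: tendsto_eq_intros)
    qed
  qed
qed

text \<open>
  An infimum of functions continuous from the right is upper semicontinuous from the right; together
  with monotonicity this gives right-continuity.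
\<close>

lemma right_slope_right_continuous:
  assumes A: "pickands A" and s: "s \<in> {0<..<1}"
  shows "(right_slope A \<longlongrightarrow> right_slope A s) (at_right s)"
proof -
  have s1: "s < 1" using s by simp
  have near: "\<forall>\<^sub>F r in at_right s. r \<in> {s<..<t}" if "s < t" for t
    using that by (rule eventually_at_right_real)
  show ?thesis
  proof (rule order_tendstoI)
  fix a assume a: "a < right_slope A s"
  show "\<forall>\<^sub>F r in at_right s. a < right_slope A r"
    using near[of 1, OF s1] by eventually_elim (use s a right_slope_mono[OF A s] in \<open>auto elim!: less_le_trans\<close>)
next
  fix a assume a: "right_slope A s < a"
  have "(\<lambda>t. (A s - A t) / (s - t)) ` ({s<..} \<inter> {0..1}) \<noteq> {}" using s by (auto intro!: bexI[of _ 1])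
  from cInf_lessD[OF this a[unfolded right_slope_def]]
  obtain t where t: "s < t" "t \<le> 1" "(A s - A t) / (s - t) < a"
    by auto
  have "((\<lambda>r. (A r - A t) / (r - t)) \<longlongrightarrow> (A s - A t) / (s - t)) (at_right s)"
    using pickands_isCont[OF A s] t
    by (intro tendsto_intros) (auto simp: isCont_def intro: tendsto_mono[rotated] at_le)
  hence "\<forall>\<^sub>F r in at_right s. (A r - A t) / (r - t) < a"
    using t(3) by (rule order_tendstoD)
  with near[OF t(1)] show "\<forall>\<^sub>F r in at_right s. right_slope A r < a"
  proof eventually_elim
    case (elim r)
    have "A r + right_slope A r * (t - r) \<le> A t"
      using right_slope_subgradient[OF A, of r t] elim t s by auto
    hence "right_slope A r \<le> (A r - A t) / (r - t)"
      using elim by (simp add: field_simps)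
    thus ?case using elim by simp
  qed
qed
qed

text \<open>
  The difference quotient between \<open>s\<close> and \<open>t\<close> lies between the slopes of the tangents at the two
  points, and the slope is continuous at \<open>s\<close>.
\<close>

lemma pickands_has_derivative:
  assumes A: "pickands A" and s: "s \<in> {0<..<1}" and cont: "isCont (right_slope A) s"
  shows "(A has_real_derivative right_slope A s) (at s)"
proof -
  have "((\<lambda>t. (A t - A s) / (t - s) - right_slope A s) \<longlongrightarrow> 0) (at s)"
  proof (rule Lim_null_comparison)
    show "((\<lambda>t. \<bar>right_slope A t - right_slope A s\<bar>) \<longlongrightarrow> 0) (at s)"
      using cont by (auto simp: isCont_def intro!: tendsto_eq_intros)
    have "\<forall>\<^sub>F t in at s. t \<in> {0<..<1} \<and> t \<noteq> s"
      using s eventually_at_in_open[of "{0<..<1}" s] by simp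
    thus "\<forall>\<^sub>F t in at s. norm ((A t - A s) / (t - s) - right_slope A s) \<le> \<bar>right_slope A t - right_slope A s\<bar>"
    proof eventually_elim
      case (elim t)
      define q where "q = (A t - A s) / (t - s)"
      have "A s + right_slope A s * (t - s) \<le> A t" "A t + right_slope A t * (s - t) \<le> A s"
        using right_slope_subgradient[OF A, of s t] right_slope_subgradient[OF A, of t s] elim s by auto
      hence "right_slope A s \<le> q \<and> q \<le> right_slope A t \<or> right_slope A t \<le> q \<and> q \<le> right_slope A s"
        using elim by (cases "s < t") (auto simp: q_def field_simps)
      thus ?case unfolding q_def[symmetric] by auto
    qed
  qed
  hence "((\<lambda>t. (A t - A s) / (t - s)) \<longlongrightarrow> right_slope A s) (at s)" by (simp add: LIM_zero_iff)
  thus ?thesis by (simp add: has_field_derivative_iff)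
qed

definition kinks :: "(real \<Rightarrow> real) \<Rightarrow> real set" where
  "kinks A = {s\<in>{0<..<1}. \<not> isCont (right_slope A) s}"

lemma countable_kinks: "pickands A \<Longrightarrow> countable (kinks A)"
  unfolding kinks_def by (intro mono_on_ctble_discont_open right_slope_mono_on) auto

lemma pickands_has_derivative':
  assumes "pickands A" "s \<in> {0<..<1}" "s \<notin> kinks A"
  shows "(A has_real_derivative right_slope A s) (at s)"
  using assms by (intro pickands_has_derivative) (auto simp: kinks_def)

section \<open>Integration over the open unit interval\<close>

definition unif :: "real measure" where
  "unif = restrict_space lborel {0<..<1}"

lemma space_unif [simp]: "space unif = {0<..<1}"
  by (simp add: unif_def space_restrict_space)

lemma prob_space_unif: "prob_space unif"
  by (rule prob_spaceI) (simp add: unif_def space_restrict_space emeasure_restrict_space)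

lemma measurable_unif_borel: "f \<in> borel_measurable borel \<Longrightarrow> f \<in> borel_measurable unif"
  unfolding unif_def by (intro measurable_restrict_space1) simp

lemma measurable_unif_continuous_on:
  fixes f :: "real \<Rightarrow> real"
  assumes "continuous_on {0<..<1} f"
  shows "f \<in> borel_measurable unif"
  using borel_measurable_continuous_on_restrict[OF assms]
  unfolding unif_def by (simp cong: measurable_cong_sets sets_restrict_space_cong)

lemma measurable_unif_mono_on:
  fixes f :: "real \<Rightarrow> real"
  assumes "mono_on {0<..<1} f"
  shows "f \<in> borel_measurable unif"
  using borel_measurable_mono_on_fnc[OF assms]
  unfolding unif_def by (simp cong: measurable_cong_sets sets_restrict_space_cong)

text \<open>
  Nonnegativity of the integrand lets the Henstock-Kurzweil integral of the countable-exception
  theorem be read as a Lebesgue integral, however singular the integrand is at the end points.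
\<close>

lemma nn_integral_unif_FTC:
  fixes F f :: "real \<Rightarrow> real"
  assumes ab: "0 \<le> a" "a \<le> b" "b \<le> 1" and N: "countable N" and cont: "continuous_on {a..b} F"
    and deriv: "\<And>x. a < x \<Longrightarrow> x < b \<Longrightarrow> x \<notin> N \<Longrightarrow> (F has_real_derivative f x) (at x)"
    and nonneg: "\<And>x. a < x \<Longrightarrow> x < b \<Longrightarrow> 0 \<le> f x"
    and meas: "f \<in> borel_measurable unif"
  shows "(\<integral>\<^sup>+x. ennreal (f x) * indicator {a<..<b} x \<partial>unif) = ennreal (F b - F a)"
proof -
  define h where "h x = (f x * indicator {0<..<1} x) * indicator {a<..<b} x" for x
  have "(f has_integral (F b - F a)) {a<..<b}"
    using fundamental_theorem_of_calculus_countable[OF ab(2) N cont deriv]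
    by (simp add: has_integral_Icc_iff_Ioo)
  moreover have h: "h x = (if x \<in> {a<..<b} then f x else 0)" for x
    using ab by (auto simp: h_def)
  ultimately have "(h has_integral (F b - F a)) UNIV"
    by (simp only: h[abs_def] has_integral_restrict_UNIV)
  moreover have "(\<lambda>x. f x * indicator {0<..<1} x) \<in> borel_measurable borel"
    using meas by (simp add: unif_def borel_measurable_restrict_space_iff mult.commute)
  hence "h \<in> borel_measurable borel" unfolding h_def[abs_def] by measurable
  moreover have "0 \<le> h x" for x using h nonneg by simp
  ultimately have "(\<integral>\<^sup>+x. ennreal (h x) \<partial>lborel) = ennreal (F b - F a)"
    by (intro nn_integral_has_integral_lborel) auto
  moreover have "(\<integral>\<^sup>+x. ennreal (f x) * indicator {a<..<b} x \<partial>unif) = (\<integral>\<^sup>+x. ennreal (h x) \<partial>lborel)"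
    unfolding unif_def by (subst nn_integral_restrict_space) (auto simp: h_def intro!: nn_integral_cong split: split_indicator)
  ultimately show ?thesis by simp
qed

section \<open>Conditional distribution functions of the extreme-value copula\<close>

lemma measurable_pickands:
  assumes "pickands A"
  shows "A \<in> borel_measurable unif" "right_slope A \<in> borel_measurable unif"
    "tangent_at_0 A \<in> borel_measurable unif" "tangent_at_1 A \<in> borel_measurable unif"
proof -
  show A[measurable]: "A \<in> borel_measurable unif"
    by (intro measurable_unif_continuous_on continuous_on_subset[OF pickands_continuous_on[OF assms]]) auto
  show [measurable]: "right_slope A \<in> borel_measurable unif"
    by (intro measurable_unif_mono_on right_slope_mono_on assms)
  have id: "(\<lambda>s. s) \<in> borel_measurable unif"
    by (intro measurable_unif_borel) simp
  show "tangent_at_0 A \<in> borel_measurable unif" "tangent_at_1 A \<in> borel_measurable unif"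
    unfolding tangent_at_0_def[abs_def] tangent_at_1_def[abs_def]
    by (intro borel_measurable_add borel_measurable_diff borel_measurable_times id borel_measurable_const; measurable)+
qed

text \<open>
  The conditional distribution function of the second coordinate given that the first one is \<open>x\<close>,
  that is, the partial derivative of the copula in \<open>x\<close>. It is parametrised not by the ordinate \<open>y\<close>
  but by \<open>s = ln x / ln (x y)\<close>, which increases with \<open>y\<close>; the ordinate belonging to \<open>s\<close> is
  \<open>x powr ((1 - s) / s)\<close>. In these coordinates the copula is the
  single power \<open>x powr (A s / s)\<close>.
\<close>

definition cond_cdf :: "(real \<Rightarrow> real) \<Rightarrow> real \<Rightarrow> real \<Rightarrow> real" where
  "cond_cdf A x s = x powr (A s / s - 1) * tangent_at_1 A s"

text \<open>
  The generalised inverse of \<open>cond_cdf A x\<close>. Inserting \<open>1\<close>, which corresponds to the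
  ordinate \<open>1\<close>, makes the set visibly nonempty.
\<close>

definition quantile :: "(real \<Rightarrow> real) \<Rightarrow> real \<Rightarrow> real \<Rightarrow> real" where
  "quantile A x w = Inf (insert 1 {s\<in>{0<..<1}. w \<le> cond_cdf A x s})"

lemma ev_copula_curve:
  assumes A: "pickands A" and x: "x \<in> {0<..<1}" and s: "s \<in> {0<..1}"
  shows "ev_copula A x (x powr ((1 - s) / s)) = x powr (A s / s)"
proof (cases "s = 1")
  case True
  thus ?thesis using x pickands_ends[OF A] by (simp add: ev_copula_def)
next
  case False
  hence "(1 - s) / s > 0" using s by simp
  hence y: "x powr ((1 - s) / s) \<in> {0<..<1}" using x powr_less_mono2[of "(1 - s) / s" x 1] by simp
  have "x * x powr ((1 - s) / s) = x powr (1 + (1 - s) / s)" using x by (simp add: powr_add)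
  also have "1 + (1 - s) / s = 1 / s" using s by (simp add: field_simps)
  finally have xy: "x * x powr ((1 - s) / s) = x powr (1 / s)" .
  have "ln x / ln (x powr (1 / s)) = s" using x s by (simp add: ln_powr)
  thus ?thesis using x y s False by (simp add: ev_copula_def xy powr_powr)
qed

text \<open>
  The slope of the line from the origin to the graph has derivative
  \<open>- tangent_at_0 A s / s\<^sup>2\<close>, which is not positive.
\<close>

lemma ratio_antimono:
  assumes A: "pickands A" and st: "s \<in> {0<..<1}" "t \<in> {0<..<1}" "s \<le> t"
  shows "A t / t \<le> A s / s"
proof -
  have "A t + right_slope A t * (s - t) \<le> A s" using right_slope_subgradient[OF A, of t s] st by simp
  hence "t * (A t + right_slope A t * (s - t)) \<le> t * A s" using st by (intro mult_left_mono) auto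
  moreover have "0 \<le> (t - s) * tangent_at_0 A t"
    using tangent_at_0_bounds[OF A, of t] st by simp
  ultimately have "s * A t \<le> t * A s" by (simp add: tangent_at_0_def algebra_simps)
  thus ?thesis using st by (simp add: field_simps)
qed

lemma ratio_ge_1:
  assumes A: "pickands A" and "s \<in> {0<..<1}"
  shows "1 \<le> A s / s"
  using pickands_bounds[OF A, of s] assms by simp

lemma cond_cdf_bounds:
  assumes A: "pickands A" and x: "x \<in> {0<..<1}" and s: "s \<in> {0<..<1}"
  shows "0 \<le> cond_cdf A x s" "cond_cdf A x s \<le> 1"
proof -
  have "x powr (A s / s - 1) \<le> 1" using x ratio_ge_1[OF A s] by (simp add: powr_le1)
  thus "0 \<le> cond_cdf A x s" "cond_cdf A x s \<le> 1"
    using tangent_at_1_bounds[OF A s] by (auto simp: cond_cdf_def intro: mult_le_one)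
qed

lemma cond_cdf_mono:
  assumes A: "pickands A" and x: "x \<in> {0<..<1}"
    and st: "s \<in> {0<..<1}" "t \<in> {0<..<1}" "s \<le> t"
  shows "cond_cdf A x s \<le> cond_cdf A x t"
  unfolding cond_cdf_def
proof (intro mult_mono)
  show "x powr (A s / s - 1) \<le> x powr (A t / t - 1)"
    using x ratio_antimono[OF A st] by (intro powr_mono') auto
qed (use tangent_at_1_bounds[OF A] tangent_at_1_mono[OF A st] st in auto)

lemma cond_cdf_right_continuous:
  assumes A: "pickands A" and x: "x \<in> {0<..<1}" and s: "s \<in> {0<..<1}"
  shows "(cond_cdf A x \<longlongrightarrow> cond_cdf A x s) (at_right s)"
proof -
  have "(A \<longlongrightarrow> A s) (at_right s)"
    using pickands_isCont[OF A s] unfolding isCont_def by (rule tendsto_mono[rotated]) (simp add: at_le)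
  thus ?thesis
    unfolding cond_cdf_def[abs_def] tangent_at_1_def[abs_def]
    using x s by (intro tendsto_intros right_slope_right_continuous[OF A s]) auto
qed

lemma quantile_bounds:
  shows "quantile A x w \<in> {0..1}"
  unfolding quantile_def by (auto intro!: cInf_greatest cInf_lower bdd_belowI[of _ 0])

text \<open>
  By right-continuity the set of arguments at which \<open>cond_cdf A x\<close> has reached \<open>w\<close> contains its
  infimum whenever that lies strictly between \<open>0\<close> and \<open>1\<close>.
\<close>

lemma quantile_le_iff:
  assumes A: "pickands A" and x: "x \<in> {0<..<1}" and s: "s \<in> {0<..<1}"
  shows "quantile A x w \<le> s \<longleftrightarrow> w \<le> cond_cdf A x s"
proof
  assume "w \<le> cond_cdf A x s"
  thus "quantile A x w \<le> s" unfolding quantile_def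
    using s by (intro cInf_lower) (auto intro!: bdd_belowI[of _ 0])
next
  assume le: "quantile A x w \<le> s"
  show "w \<le> cond_cdf A x s"
  proof (rule ccontr)
    assume "\<not> w \<le> cond_cdf A x s"
    hence "\<forall>\<^sub>F r in at_right s. cond_cdf A x r < w"
      by (intro order_tendstoD(2)[OF cond_cdf_right_continuous[OF A x s]]) simp
    moreover have "\<forall>\<^sub>F r in at_right s. r \<in> {s<..<1}"
      using s by (intro eventually_at_right_real) auto
    ultimately have "\<forall>\<^sub>F r in at_right s. cond_cdf A x r < w \<and> r \<in> {s<..<1}"
      by eventually_elim auto
    from eventually_happens[OF this] obtain r where r: "cond_cdf A x r < w" "s < r" "r < 1"
      by (auto simp: trivial_limit_at_right_real)
    have "r \<le> quantile A x w" unfolding quantile_def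
    proof (rule cInf_greatest)
      fix t assume t: "t \<in> insert 1 {s \<in> {0<..<1}. w \<le> cond_cdf A x s}"
      show "r \<le> t"
      proof (rule ccontr)
        assume "\<not> r \<le> t"
        hence t': "t \<in> {0<..<1}" "w \<le> cond_cdf A x t" "t \<le> r" using t r by auto
        have "cond_cdf A x t \<le> cond_cdf A x r"
          by (rule cond_cdf_mono[OF A x]) (use t' r s in auto)
        thus False using t' r by simp
      qed
    qed auto
    thus False using le r by simp
  qed
qed

text \<open>
  The value \<open>0\<close> is put in at \<open>s = 0\<close>, where division by zero would give \<open>1\<close>. The limit is
  right because \<open>A s \<ge> 1 - s\<close> lets the exponent tend to infinity.
\<close>

lemma continuous_on_curve:
  assumes A: "pickands A" and x: "x \<in> {0<..<1}"
  shows "continuous_on {0..1} (\<lambda>s. if s = 0 then 0 else x powr (A s / s))"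
  unfolding continuous_on_def
proof
  fix s :: real assume s: "s \<in> {0..1}"
  let ?f = "\<lambda>s. if s = 0 then 0 else x powr (A s / s)"
  show "(?f \<longlongrightarrow> ?f s) (at s within {0..1})"
  proof (cases "s = 0")
    case True
    have lim: "((\<lambda>s. x powr ((1 - s) / s)) \<longlongrightarrow> 0) (at_right 0)"
      using x by real_asymp
    have ev: "\<forall>\<^sub>F t in at 0 within {0..1}. t \<in> {0<..1::real}"
      by (auto simp: eventually_at_filter)
    have "(?f \<longlongrightarrow> 0) (at 0 within {0..1})"
    proof (rule tendsto_sandwich[of "\<lambda>_. 0"])
      show "((\<lambda>s. x powr ((1 - s) / s)) \<longlongrightarrow> 0) (at 0 within {0..1})"
        using lim by (simp add: at_within_Icc_at_right)
      show "\<forall>\<^sub>F t in at 0 within {0..1}. ?f t \<le> x powr ((1 - t) / t)"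
        using ev
      proof eventually_elim
        case (elim t)
        thus ?case using x pickands_bounds[OF A, of t] by (auto intro!: powr_mono' divide_right_mono)
      qed
    qed (auto intro: always_eventually)
    thus ?thesis using True by simp
  next
    case False
    have "(A \<longlongrightarrow> A s) (at s within {0..1})"
      using pickands_continuous_on[OF A] s by (simp add: continuous_on_def)
    hence "((\<lambda>s. x powr (A s / s)) \<longlongrightarrow> x powr (A s / s)) (at s within {0..1})"
      using x False by (intro tendsto_intros) auto
    moreover have "\<forall>\<^sub>F t in at s within {0..1}. t \<noteq> 0"
      using False by (intro tendsto_imp_eventually_ne[OF tendsto_ident_at])
    hence "\<forall>\<^sub>F t in at s within {0..1}. ?f t = x powr (A t / t)"
      by eventually_elim simp
    ultimately show ?thesis using False by (simp add: tendsto_cong)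
  qed
qed

text \<open>
  The conditional distribution function tends to \<open>0\<close> at the left end, being at most the copula
  divided by \<open>x\<close>.
\<close>

lemma quantile_pos:
  assumes A: "pickands A" and x: "x \<in> {0<..<1}" and w: "w \<in> {0<..<1}"
  shows "quantile A x w \<in> {0<..1}"
proof -
  let ?f = "\<lambda>s. if s = 0 then 0 else x powr (A s / s)"
  have "(?f \<longlongrightarrow> 0) (at_right 0)"
    using continuous_on_curve[OF A x] by (auto simp: continuous_on_def at_within_Icc_at_right dest!: bspec[of _ _ 0])
  hence "\<forall>\<^sub>F s in at_right 0. ?f s < x * w"
    using x w by (intro order_tendstoD) auto
  moreover have "\<forall>\<^sub>F s in at_right 0. s \<in> {0<..<1::real}" by (intro eventually_at_right_real) auto
  ultimately have "\<forall>\<^sub>F s in at_right 0. ?f s < x * w \<and> s \<in> {0<..<1}" by eventually_elim auto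
  from eventually_happens[OF this] obtain s where s: "s \<in> {0<..<1}" "x powr (A s / s) < x * w"
    by (auto simp: trivial_limit_at_right_real)
  have "cond_cdf A x s \<le> x powr (A s / s - 1) * 1"
    unfolding cond_cdf_def using tangent_at_1_bounds[OF A s(1)] by (intro mult_left_mono) auto
  also have "\<dots> = x powr (A s / s) / x" using x by (simp add: powr_diff)
  also have "\<dots> < w" using x s(2) by (simp add: pos_divide_less_eq mult.commute)
  finally have "\<not> quantile A x w \<le> s" using quantile_le_iff[OF A x s(1)] by simp
  thus ?thesis using s quantile_bounds[of A x w] by simp
qed

interpretation unif: prob_space unif by (rule prob_space_unif)
interpretation unif_pair: pair_prob_space unif unif ..

lemma measurable_unif_ident [measurable]: "(\<lambda>x. x) \<in> borel_measurable unif"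
  by (intro measurable_unif_borel) simp

lemma emeasure_unif_Ioc:
  assumes "0 \<le> c" "c \<le> 1"
  shows "emeasure unif {w\<in>{0<..<1}. w \<le> c} = ennreal c"
    and "emeasure unif {w\<in>{0<..<1}. c < w} = ennreal (1 - c)"
proof -
  have "emeasure unif {w\<in>{0<..<1}. w \<le> c} = emeasure lborel {w\<in>{0<..<1}. w \<le> c}"
    unfolding unif_def by (intro emeasure_restrict_space) auto
  also have "\<dots> = emeasure lborel (if c = 1 then {0<..<1} else {0<..c})"
    using assms by (intro arg_cong[of _ _ "emeasure lborel"]) auto
  finally show "emeasure unif {w\<in>{0<..<1}. w \<le> c} = ennreal c" using assms by auto
  have "{w\<in>{0<..<1}. c < w} = {c<..<1}" using assms by auto
  moreover have "emeasure unif {c<..<1} = emeasure lborel {c<..<1}"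
    using assms unfolding unif_def by (intro emeasure_restrict_space) auto
  ultimately show "emeasure unif {w\<in>{0<..<1}. c < w} = ennreal (1 - c)" using assms by simp
qed

lemma AE_unif_neq: "AE x in unif. x \<noteq> c"
  using AE_lborel_singleton[of c] unfolding unif_def by (subst AE_restrict_space_iff) auto

lemma nn_integral_unif_indicator_1:
  "(\<integral>\<^sup>+x. f x * indicator {0<..<1} x \<partial>unif) = (\<integral>\<^sup>+x. f x \<partial>unif)"
  by (intro nn_integral_cong) simp

lemma nn_integral_unif_ident: "(\<integral>\<^sup>+x. ennreal x \<partial>unif) = ennreal (1/2)"
proof -
  have "(\<integral>\<^sup>+x. ennreal x * indicator {0<..<1} x \<partial>unif) = ennreal (1\<^sup>2 / 2 - 0\<^sup>2 / 2)"
    by (rule nn_integral_unif_FTC[where N = "{}"]) (auto intro!: derivative_eq_intros continuous_intros)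
  thus ?thesis by (simp add: nn_integral_unif_indicator_1)
qed

text \<open>
  The first moment of an exponential distribution with rate \<open>c\<close>, up to the factor \<open>c\<close>, after the
  substitution \<open>t = - ln x\<close>.
\<close>

lemma nn_integral_powr_neg_ln:
  assumes c: "0 < c"
  shows "(\<integral>\<^sup>+x. ennreal (x powr (c - 1) * (- ln x)) \<partial>unif) = ennreal (1 / c\<^sup>2)"
proof -
  define F where "F x = x powr c * (1 / c\<^sup>2 - ln x / c)" for x
  have "(\<integral>\<^sup>+x. ennreal (x powr (c - 1) * (- ln x)) * indicator {0<..<1} x \<partial>unif) = ennreal (F 1 - F 0)"
  proof (rule nn_integral_unif_FTC[where N = "{}"])
    show "continuous_on {0..1} F" unfolding continuous_on_def
    proof
      fix x :: real assume x: "x \<in> {0..1}"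
      show "(F \<longlongrightarrow> F x) (at x within {0..1})"
      proof (cases "x = 0")
        case True
        have "(F \<longlongrightarrow> 0) (at_right 0)" unfolding F_def using c by real_asymp
        thus ?thesis using True by (simp add: at_within_Icc_at_right F_def)
      next
        case False
        thus ?thesis unfolding F_def using x c by (intro tendsto_intros) auto
      qed
    qed
    fix x :: real assume x: "0 < x" "x < 1"
    show "(F has_real_derivative x powr (c - 1) * - ln x) (at x)"
      unfolding F_def using x c
      by (auto intro!: derivative_eq_intros simp: field_simps powr_diff power2_eq_square)
    show "0 \<le> x powr (c - 1) * - ln x" using x by (simp add: mult_nonneg_nonpos)
  next
    show "(\<lambda>x. x powr (c - 1) * - ln x) \<in> borel_measurable unif" by measurable
  qed auto
  thus ?thesis by (simp add: nn_integral_unif_indicator_1 F_def)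
qed

lemma measurable_cond_cdf:
  assumes "pickands A"
  shows "(\<lambda>p. cond_cdf A (fst p) (snd p)) \<in> borel_measurable (unif \<Otimes>\<^sub>M unif)"
proof -
  note [measurable] = measurable_pickands[OF assms]
  show ?thesis unfolding cond_cdf_def by measurable
qed

text \<open>
  The integrand is the partial derivative of the copula in \<open>x\<close>, except where \<open>ln x / ln (x y)\<close>
  hits a kink of \<open>A\<close>; this map is injective, so only countably many \<open>x\<close> are affected.
\<close>

lemma nn_integral_cond_cdf:
  assumes A: "pickands A" and x0: "x0 \<in> {0..1}" and y: "y \<in> {0<..<1}"
  shows "(\<integral>\<^sup>+x. ennreal (cond_cdf A x (ln x / ln (x * y))) * indicator {0<..<x0} x \<partial>unif)
      = ennreal (ev_copula A x0 y)"
proof -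
  define s where "s x = ln x / ln (x * y)" for x
  \<comment> \<open>The image of the kinks under the inverse of \<open>s\<close>.\<close>
  define N where "N = (\<lambda>s. exp (s * ln y / (1 - s))) ` kinks A"
  have s01: "s x \<in> {0<..<1}" if "0 < x" "x < 1" for x
    using ev_copula_arg(1)[of x y] that y by (simp add: s_def)
  have "(\<integral>\<^sup>+x. ennreal (cond_cdf A x (s x)) * indicator {0<..<x0} x \<partial>unif)
      = ennreal (ev_copula A x0 y - ev_copula A 0 y)"
  proof (rule nn_integral_unif_FTC)
    show "countable N" unfolding N_def by (intro countable_image countable_kinks A)
    show "continuous_on {0..x0} (\<lambda>x. ev_copula A x y)"
    proof -
      have "continuous_on {0..x0} (\<lambda>x. (x, y))" by (intro continuous_intros)
      from continuous_on_compose2[OF continuous_on_ev_copula[OF A] this] show ?thesis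
        using x0 y by (simp add: image_subset_iff)
    qed
    fix x assume x: "0 < x" "x < x0"
    hence x1: "x < 1" using x0 by simp
    define l where "l = ln (x * y)"
    have l: "l < 0" using ev_copula_arg(3)[of x y] x x1 y by (simp add: l_def)
    have lnx: "ln x = s x * l" using l by (simp add: s_def l_def)
    have lxy: "ln x + ln y = l" using x y by (simp add: l_def ln_mult)
    show "0 \<le> cond_cdf A x (s x)" using cond_cdf_bounds[OF A _ s01] x x1 by simp
    assume "x \<notin> N"
    have "s x \<notin> kinks A"
    proof
      assume "s x \<in> kinks A"
      moreover have "ln y = (1 - s x) * l" using lnx lxy by (simp add: algebra_simps)
      hence "s x * ln y / (1 - s x) = ln x"
        using s01[of x] x x1 lnx by simp
      hence "x = exp (s x * ln y / (1 - s x))" using x by simp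
      ultimately show False using \<open>x \<notin> N\<close> unfolding N_def by blast
    qed
    hence dA: "(A has_real_derivative right_slope A (s x)) (at (s x))"
      using pickands_has_derivative'[OF A] s01 x x1 by blast
    have ds: "(s has_real_derivative (1 - s x) / (x * l)) (at x)"
    proof -
      have "(s has_real_derivative (1 / x * l - ln x * (1 * y / (x * y))) / (l * l)) (at x)"
        unfolding s_def l_def using x y l[unfolded l_def]
        by (auto intro!: derivative_eq_intros simp: field_simps)
      also have "(1 / x * l - ln x * (1 * y / (x * y))) / (l * l) = (1 - s x) / (x * l)"
        using x y l unfolding lnx by (simp add: field_simps)
      finally show ?thesis .
    qed
    have dl: "((\<lambda>x. ln (x * y)) has_real_derivative 1 / x) (at x)"
      using x y by (auto intro!: derivative_eq_intros)
    have "((\<lambda>x. exp (A (s x) * ln (x * y))) has_real_derivative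
        exp (A (s x) * l) * (right_slope A (s x) * ((1 - s x) / (x * l)) * l + 1 / x * A (s x))) (at x)"
      unfolding l_def by (intro DERIV_fun_exp DERIV_mult dl DERIV_chain2[where f = A and g = s, OF dA ds[unfolded l_def]])
    also have "exp (A (s x) * l) * (right_slope A (s x) * ((1 - s x) / (x * l)) * l + 1 / x * A (s x))
        = exp (A (s x) * l) / x * tangent_at_1 A (s x)"
      using l x by (simp add: tangent_at_1_def field_simps)
    also have "exp (A (s x) * l) / x = x powr (A (s x) / s x - 1)"
    proof -
      have "A (s x) / s x * ln x = A (s x) * l" using s01[of x] x x1 by (simp add: lnx)
      moreover have "x powr (A (s x) / s x - 1) = x powr (A (s x) / s x) / x"
        using x by (simp add: powr_diff)
      ultimately show ?thesis using x by (simp add: powr_def)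
    qed
    finally have "((\<lambda>x. exp (A (s x) * ln (x * y))) has_real_derivative cond_cdf A x (s x)) (at x)"
      by (simp add: cond_cdf_def)
    thus "((\<lambda>x. ev_copula A x y) has_real_derivative cond_cdf A x (s x)) (at x)"
      by (rule has_field_derivative_transform_within_open[of _ _ _ "{0<..<1}"])
         (use x x1 y in \<open>auto simp: ev_copula_def s_def powr_def\<close>)
  next
    have "s \<in> borel_measurable unif" unfolding s_def by measurable
    hence "s \<in> measurable unif unif"
      using s01 by (subst (2) unif_def, intro measurable_restrict_space2) auto
    hence "(\<lambda>x. (x, s x)) \<in> measurable unif (unif \<Otimes>\<^sub>M unif)" by measurable
    from measurable_compose[OF this measurable_cond_cdf[OF A]]
    show "(\<lambda>x. cond_cdf A x (s x)) \<in> borel_measurable unif" by simp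
  qed (use x0 in auto)
  thus ?thesis by (simp add: s_def ev_copula_def)
qed

text \<open>
  The derivative in \<open>s\<close> of \<open>x powr (A s / s)\<close>, the value of the copula along the vertical line
  over \<open>x\<close>.
\<close>

definition curve_density :: "(real \<Rightarrow> real) \<Rightarrow> real \<Rightarrow> real \<Rightarrow> real" where
  "curve_density A x s = x powr (A s / s) * (- ln x) * tangent_at_0 A s / s\<^sup>2"

lemma curve_density_nonneg:
  assumes "pickands A" "x \<in> {0<..<1}" "s \<in> {0<..<1}"
  shows "0 \<le> curve_density A x s"
  unfolding curve_density_def using assms tangent_at_0_bounds[OF assms(1,3)]
  by (intro divide_nonneg_nonneg mult_nonneg_nonneg) auto

lemma measurable_curve_density:
  assumes "pickands A"
  shows "(\<lambda>p. curve_density A (fst p) (snd p)) \<in> borel_measurable (unif \<Otimes>\<^sub>M unif)"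
proof -
  note [measurable] = measurable_pickands[OF assms]
  show ?thesis unfolding curve_density_def by measurable
qed

lemma nn_integral_curve_density:
  assumes A: "pickands A" and x: "x \<in> {0<..<1}" and b: "b \<in> {0<..1}"
  shows "(\<integral>\<^sup>+s. ennreal (curve_density A x s) * indicator {0<..<b} s \<partial>unif) = ennreal (x powr (A b / b))"
proof -
  let ?F = "\<lambda>s. if s = 0 then 0 else x powr (A s / s)"
  have "(\<integral>\<^sup>+s. ennreal (curve_density A x s) * indicator {0<..<b} s \<partial>unif) = ennreal (?F b - ?F 0)"
  proof (rule nn_integral_unif_FTC)
    show "countable (kinks A)" by (rule countable_kinks[OF A])
    show "continuous_on {0..b} ?F"
      by (rule continuous_on_subset[OF continuous_on_curve[OF A x]]) (use b in auto)
    fix s assume "0 < s" "s < b"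
    hence s: "s \<in> {0<..<1}" using b by auto
    show "0 \<le> curve_density A x s" by (rule curve_density_nonneg[OF A x s])
    assume "s \<notin> kinks A"
    note dA = pickands_has_derivative'[OF A s this]
    have "((\<lambda>s. exp (A s / s * ln x)) has_real_derivative
       exp (A s / s * ln x) * ((right_slope A s * s - A s * 1) / (s * s) * ln x)) (at s)"
      using s by (intro DERIV_fun_exp DERIV_cmult_right DERIV_divide dA DERIV_ident) auto
    also have "exp (A s / s * ln x) * ((right_slope A s * s - A s * 1) / (s * s) * ln x) = curve_density A x s"
      using x s by (simp add: curve_density_def powr_def tangent_at_0_def power2_eq_square field_simps)
    finally show "(?F has_real_derivative curve_density A x s) (at s)"
      by (rule has_field_derivative_transform_within_open[of _ _ _ "{0<..<1}"])
         (use x s in \<open>auto simp: powr_def\<close>)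
  next
    have "(\<lambda>s. (x, s)) \<in> measurable unif (unif \<Otimes>\<^sub>M unif)" using x by simp
    from measurable_compose[OF this measurable_curve_density[OF A]]
    show "curve_density A x \<in> borel_measurable unif" by simp
  qed (use b in auto)
  thus ?thesis using b by simp
qed

lemma measurable_quantile:
  assumes A: "pickands A"
  shows "(\<lambda>p. quantile A (fst p) (snd p)) \<in> borel_measurable (unif \<Otimes>\<^sub>M unif)"
proof (subst borel_measurable_iff_le, intro allI)
  fix a :: real
  let ?S = "{p \<in> space (unif \<Otimes>\<^sub>M unif). quantile A (fst p) (snd p) \<le> a}"
  consider "a \<le> 0" | "a \<in> {0<..<1}" | "1 \<le> a" by fastforce
  thus "?S \<in> sets (unif \<Otimes>\<^sub>M unif)"
  proof cases
    \<comment> \<open>At or below \<open>0\<close> the equivalence with \<open>cond_cdf\<close> does not apply; positivity of the quantile makes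
      the set empty.\<close>
    case 1
    have "?S = {}" using quantile_pos[OF A] 1 by (fastforce simp: space_pair_measure)
    thus ?thesis by (simp only: sets.empty_sets)
  next
    case 2
    have "?S = {p \<in> space (unif \<Otimes>\<^sub>M unif). snd p \<le> cond_cdf A (fst p) a}"
      using quantile_le_iff[OF A _ 2] by (auto simp: space_pair_measure)
    moreover have "(\<lambda>p. (fst p, a)) \<in> measurable (unif \<Otimes>\<^sub>M unif) (unif \<Otimes>\<^sub>M unif)"
      using 2 by simp
    from measurable_compose[OF this measurable_cond_cdf[OF A]]
    have [measurable]: "(\<lambda>p. cond_cdf A (fst p) a) \<in> borel_measurable (unif \<Otimes>\<^sub>M unif)" by simp
    have "{p \<in> space (unif \<Otimes>\<^sub>M unif). snd p \<le> cond_cdf A (fst p) a} \<in> sets (unif \<Otimes>\<^sub>M unif)"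
      by measurable
    ultimately show ?thesis by simp
  next
    case 3
    have "?S = space (unif \<Otimes>\<^sub>M unif)"
      using 3 quantile_bounds[of A] by (auto intro: order_trans)
    thus ?thesis by (simp only: sets.top)
  qed
qed

section \<open>A random vector distributed according to the copula\<close>

text \<open>
  The conditional quantile transform: two independent uniform variables \<open>x\<close> and \<open>w\<close> are turned into
  a vector whose first coordinate is \<open>x\<close> and whose second coordinate has, given \<open>x\<close>, the
  distribution function \<open>cond_cdf A x\<close> in the coordinate \<open>s\<close>.
\<close>

definition ev_pair :: "(real \<Rightarrow> real) \<Rightarrow> real \<times> real \<Rightarrow> real \<times> real" where
  "ev_pair A p = (fst p, fst p powr ((1 - quantile A (fst p) (snd p)) / quantile A (fst p) (snd p)))"

abbreviation unit_square :: "(real \<times> real) measure" where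
  "unit_square \<equiv> restrict_space borel ({0..1} \<times> {0..1})"

lemma measurable_unif_pair_fst_snd [measurable]:
  "fst \<in> borel_measurable (unif \<Otimes>\<^sub>M unif)" "snd \<in> borel_measurable (unif \<Otimes>\<^sub>M unif)"
  by (auto intro: measurable_compose[OF measurable_fst measurable_unif_ident]
      measurable_compose[OF measurable_snd measurable_unif_ident])

lemma measurable_ev_pair:
  assumes A: "pickands A"
  shows "ev_pair A \<in> measurable (unif \<Otimes>\<^sub>M unif) unit_square"
proof (rule measurable_restrict_space2)
  note [measurable] = measurable_quantile[OF A]
  show "ev_pair A \<in> borel_measurable (unif \<Otimes>\<^sub>M unif)"
    unfolding ev_pair_def[abs_def] borel_prod[symmetric] by measurable
  show "ev_pair A \<in> space (unif \<Otimes>\<^sub>M unif) \<rightarrow> {0..1} \<times> {0..1}"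
    using quantile_bounds[of A] by (auto simp: space_pair_measure ev_pair_def intro!: powr_le1)
qed

definition ev_law :: "(real \<Rightarrow> real) \<Rightarrow> (real \<times> real) measure" where
  "ev_law A = distr (unif \<Otimes>\<^sub>M unif) unit_square (ev_pair A)"

lemma prob_space_ev_law: "pickands A \<Longrightarrow> prob_space (ev_law A)"
  unfolding ev_law_def by (intro unif_pair.prob_space_distr measurable_ev_pair)

lemma snd_ev_pair_le_iff:
  assumes A: "pickands A" and x: "x \<in> {0<..<1}" and w: "w \<in> {0<..<1}" and y: "y \<in> {0<..<1}"
  shows "snd (ev_pair A (x, w)) \<le> y \<longleftrightarrow> w \<le> cond_cdf A x (ln x / ln (x * y))"
proof -
  define S where "S = quantile A x w"
  have S: "S \<in> {0<..1}" unfolding S_def by (rule quantile_pos[OF A x w])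
  have l: "ln (x * y) < 0" "ln x / ln (x * y) \<in> {0<..<1}" using ev_copula_arg[of x y] x y by auto
  have "snd (ev_pair A (x, w)) \<le> y \<longleftrightarrow> (1 - S) / S * ln x \<le> ln y"
    using x y ln_le_cancel_iff[of "x powr ((1 - S) / S)" y] by (simp add: ev_pair_def S_def ln_powr)
  also have "\<dots> \<longleftrightarrow> (1 - S) * ln x \<le> S * ln y"
    using S by (simp add: pos_divide_le_eq mult.commute)
  also have "\<dots> \<longleftrightarrow> ln x \<le> S * ln (x * y)"
    using x y by (simp add: ln_mult algebra_simps)
  also have "\<dots> \<longleftrightarrow> S \<le> ln x / ln (x * y)"
    using l(1) by (simp add: neg_le_divide_eq)
  finally show ?thesis unfolding S_def using quantile_le_iff[OF A x l(2)] by simp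
qed

text \<open>
  The event in question is that \<open>x \<le> x0\<close> and that \<open>w\<close> is at most the conditional distribution
  function at \<open>y0\<close>, so its probability is an integral of the partial derivative of the copula.
\<close>

lemma measure_ev_law:
  assumes A: "pickands A" and x0: "x0 \<in> {0..1}" and y0: "y0 \<in> {0..1}"
  shows "measure (ev_law A) ({0..x0} \<times> {0..y0}) = ev_copula A x0 y0"
proof -
  let ?V = "{0..x0} \<times> {0..y0}"
  have V: "?V \<in> sets unit_square"
    using x0 y0 by (auto simp: sets_restrict_space_iff borel_prod[symmetric])
  define T where "T = {p \<in> space (unif \<Otimes>\<^sub>M unif). fst p \<le> x0 \<and> snd (ev_pair A p) \<le> y0}"
  have T': "ev_pair A -` ?V \<inter> space (unif \<Otimes>\<^sub>M unif) = T"
    by (auto simp: T_def ev_pair_def space_pair_measure)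
  have T: "T \<in> sets (unif \<Otimes>\<^sub>M unif)"
    using measurable_sets[OF measurable_ev_pair[OF A] V] T' by simp
  have "emeasure (ev_law A) ?V = emeasure (unif \<Otimes>\<^sub>M unif) T"
    unfolding ev_law_def using T' by (simp add: emeasure_distr measurable_ev_pair[OF A] V)
  also have "\<dots> = (\<integral>\<^sup>+x. \<integral>\<^sup>+w. indicator T (x, w) \<partial>unif \<partial>unif)"
    by (rule unif.emeasure_pair_measure[OF T])
  also have "\<dots> = (\<integral>\<^sup>+x. emeasure unif {w\<in>{0<..<1}. snd (ev_pair A (x, w)) \<le> y0} * indicator {0<..<x0} x \<partial>unif)"
  proof (rule nn_integral_cong_AE)
    have eq: "(\<integral>\<^sup>+w. indicator T (x, w) \<partial>unif) =
      emeasure unif {w\<in>{0<..<1}. snd (ev_pair A (x, w)) \<le> y0} * indicator {0<..<x0} x"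
      if x: "x \<in> {0<..<1}" "x \<noteq> x0" for x
    proof -
      have "Pair x -` T \<in> sets unif" by (rule sets_Pair1[OF T])
      hence "(\<integral>\<^sup>+w. indicator (Pair x -` T) w \<partial>unif) = emeasure unif (Pair x -` T)" by (rule nn_integral_indicator)
      moreover have "Pair x -` T = (if x < x0 then {w\<in>{0<..<1}. snd (ev_pair A (x, w)) \<le> y0} else {})"
        using x by (auto simp: T_def space_pair_measure)
      ultimately show ?thesis using x by (auto simp: indicator_def vimage_def)
    qed
    have "AE x in unif. x \<in> {0<..<1}" using AE_space[of unif] by simp
    thus "AE x in unif. (\<integral>\<^sup>+w. indicator T (x, w) \<partial>unif) =
      emeasure unif {w\<in>{0<..<1}. snd (ev_pair A (x, w)) \<le> y0} * indicator {0<..<x0} x"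
      using AE_unif_neq[of x0] by eventually_elim (rule eq)
  qed
  also have "\<dots> = ennreal (ev_copula A x0 y0)"
  proof -
    consider "y0 = 0" | "y0 = 1" | "y0 \<in> {0<..<1}" using y0 by fastforce
    thus ?thesis
    proof cases
      case 1
      have "emeasure unif {w\<in>{0<..<1}. snd (ev_pair A (x, w)) \<le> y0} = 0" if "x \<in> {0<..<1}" for x
      proof -
        have "{w\<in>{0<..<1}. snd (ev_pair A (x, w)) \<le> y0} = {}" using that 1 by (auto simp: ev_pair_def)
        thus ?thesis by (simp only: emeasure_empty)
      qed
      hence "(\<integral>\<^sup>+x. emeasure unif {w\<in>{0<..<1}. snd (ev_pair A (x, w)) \<le> y0} * indicator {0<..<x0} x \<partial>unif) =
         (\<integral>\<^sup>+x. 0 \<partial>unif)" by (intro nn_integral_cong) simp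
      thus ?thesis using 1 by (simp add: ev_copula_def)
    next
      case 2
      have "emeasure unif {w\<in>{0<..<1}. snd (ev_pair A (x, w)) \<le> y0} = 1" if "x \<in> {0<..<1}" for x
      proof -
        have "{w\<in>{0<..<1}. snd (ev_pair A (x, w)) \<le> y0} = space unif"
          using that 2 quantile_bounds[of A x] by (auto simp: ev_pair_def intro!: powr_le1)
        thus ?thesis by (simp only: unif.emeasure_space_1)
      qed
      hence "(\<integral>\<^sup>+x. emeasure unif {w\<in>{0<..<1}. snd (ev_pair A (x, w)) \<le> y0} * indicator {0<..<x0} x \<partial>unif) =
         (\<integral>\<^sup>+x. ennreal 1 * indicator {0<..<x0} x \<partial>unif)"
        by (intro nn_integral_cong) simp
      also have "\<dots> = ennreal (x0 - 0)"
        by (rule nn_integral_unif_FTC[where N = "{}"]) (use x0 in \<open>auto intro!: derivative_eq_intros\<close>)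
      finally show ?thesis using 2 by (simp add: ev_copula_def)
    next
      case 3
      have "emeasure unif {w\<in>{0<..<1}. snd (ev_pair A (x, w)) \<le> y0} = ennreal (cond_cdf A x (ln x / ln (x * y0)))"
        if x: "x \<in> {0<..<1}" for x
      proof -
        have "{w\<in>{0<..<1}. snd (ev_pair A (x, w)) \<le> y0} = {w\<in>{0<..<1}. w \<le> cond_cdf A x (ln x / ln (x * y0))}"
          using snd_ev_pair_le_iff[OF A x _ 3] by auto
        moreover have "ln x / ln (x * y0) \<in> {0<..<1}" using ev_copula_arg(1)[of x y0] x 3 by auto
        from emeasure_unif_Ioc(1)[OF cond_cdf_bounds[OF A x this]]
        have "emeasure unif {w\<in>{0<..<1}. w \<le> cond_cdf A x (ln x / ln (x * y0))} =
            ennreal (cond_cdf A x (ln x / ln (x * y0)))" .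
        ultimately show ?thesis by (simp only:)
      qed
      thus ?thesis by (subst nn_integral_cond_cdf[OF A x0 3, symmetric]) (auto intro!: nn_integral_cong)
    qed
  qed
  finally have "emeasure (ev_law A) ?V = ennreal (ev_copula A x0 y0)" .
  moreover have "0 \<le> x0 * y0" using x0 y0 by simp
  hence "0 \<le> ev_copula A x0 y0" using ev_copula_bounds(1)[OF A x0 y0] by linarith
  ultimately show ?thesis by (simp add: measure_def)
qed

text \<open>
  Transport to the whole plane turns the rectangles with lower left corner at the origin into the
  lower left quadrants, which form an intersection-stable generator of the Borel sets.
\<close>

lemma copula_measure_eqI:
  assumes M: "prob_space M" "sets M = sets unit_square"
    and eq: "\<And>x y. x \<in> {0..1} \<Longrightarrow> y \<in> {0..1} \<Longrightarrow> measure M ({0..x} \<times> {0..y}) = C x y"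
  shows "copula_measure C = M"
  unfolding copula_measure_def
proof (rule the_equality)
  fix M' assume M': "prob_space M' \<and> sets M' = sets unit_square \<and>
             (\<forall>x\<in>{0..1}. \<forall>y\<in>{0..1}. measure M' ({0..x} \<times> {0..y}) = C x y)"
  have sp: "space M = {0..1} \<times> {0..1}" "space M' = {0..1} \<times> {0..1}"
    using sets_eq_imp_space_eq[OF M(2)] sets_eq_imp_space_eq[of M' unit_square] M'
    by (auto simp: space_restrict_space)
  have idM: "(\<lambda>p. p) \<in> measurable N borel" if "sets N = sets unit_square" for N :: "(real \<times> real) measure"
    using that by (simp add: measurable_restrict_space1 cong: measurable_cong_sets)
  have atMost: "emeasure (distr N borel (\<lambda>p. p)) {..a} =
      (if 0 \<le> fst a \<and> 0 \<le> snd a then ennreal (C (min 1 (fst a)) (min 1 (snd a))) else 0)"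
    if N: "prob_space N" "sets N = sets unit_square" "space N = {0..1} \<times> {0..1}"
      and C: "\<And>x y. x \<in> {0..1} \<Longrightarrow> y \<in> {0..1} \<Longrightarrow> measure N ({0..x} \<times> {0..y}) = C x y"
    for N and a :: "real \<times> real"
  proof -
    interpret N: prob_space N by fact
    have "emeasure (distr N borel (\<lambda>p. p)) {..a} = emeasure N ({..a} \<inter> ({0..1} \<times> {0..1}))"
      using N by (simp add: emeasure_distr idM)
    also have "{..a} \<inter> ({0..1} \<times> {0..1}) = (if 0 \<le> fst a \<and> 0 \<le> snd a
        then {0..min 1 (fst a)} \<times> {0..min 1 (snd a)} else {})"
      by (auto simp: less_eq_prod_def)
    finally show ?thesis using C[of "min 1 (fst a)" "min 1 (snd a)"]
      by (auto simp: N.emeasure_eq_measure)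
  qed
  have same: "distr M' borel (\<lambda>p. p) = distr M borel (\<lambda>p. p)"
  proof (rule measure_eqI_generator_eq[where E = "range (\<lambda>a. {..a})" and \<Omega> = UNIV and A = "\<lambda>n. {..(real n, real n)}"])
    show "Int_stable (range (\<lambda>a::real \<times> real. {..a}))"
    proof (rule Int_stableI, clarify)
      fix a b c d :: real
      have "{..(a, b)} \<inter> {..(c, d)} = {..(min a c, min b d)}" by (auto simp: less_eq_prod_def)
      thus "{..(a, b)} \<inter> {..(c, d)} \<in> range (\<lambda>a. {..a})" by blast
    qed
    show "sets (distr M' borel (\<lambda>p. p)) = sigma_sets UNIV (range (\<lambda>a. {..a}))"
      "sets (distr M borel (\<lambda>p. p)) = sigma_sets UNIV (range (\<lambda>a. {..a}))"
      by (simp_all add: borel_eq_atMost)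
    show "(\<Union>n. {..(real n, real n)}) = UNIV"
    proof (rule UNIV_eq_I[symmetric])
      fix p :: "real \<times> real"
      obtain n where "max (fst p) (snd p) \<le> real n" using real_arch_simple by blast
      thus "p \<in> (\<Union>n. {..(real n, real n)})" by (auto simp: less_eq_prod_def intro!: exI[of _ n])
    qed
    show "emeasure (distr M' borel (\<lambda>p. p)) X = emeasure (distr M borel (\<lambda>p. p)) X"
      if X: "X \<in> range (\<lambda>a. {..a})" for X
    proof -
      obtain a where "X = {..a}" using X by blast
      have "emeasure (distr M' borel (\<lambda>p. p)) {..a} =
          (if 0 \<le> fst a \<and> 0 \<le> snd a then ennreal (C (min 1 (fst a)) (min 1 (snd a))) else 0)"
        by (rule atMost) (use M' sp in blast)+
      thus ?thesis using atMost[OF M sp(1) eq, of a] by (simp only: \<open>X = {..a}\<close>)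
    qed
    show "emeasure (distr M' borel (\<lambda>p. p)) {..(real i, real i)} \<noteq> \<infinity>" for i
    proof -
      interpret D: prob_space "distr M' borel (\<lambda>p. p)"
        using M' by (intro prob_space.prob_space_distr idM) auto
      show ?thesis by (simp add: D.emeasure_finite)
    qed
  qed auto
  have "emeasure (distr N borel (\<lambda>p. p)) X = emeasure N X"
    if "sets N = sets unit_square" "space N = {0..1} \<times> {0..1}" "X \<in> sets unit_square" for N X
  proof -
    have "X \<in> sets borel" "X \<subseteq> {0..1} \<times> {0..1}"
      using that(3) by (auto simp: sets_restrict_space_iff borel_prod[symmetric])
    thus ?thesis using that by (simp add: emeasure_distr idM Int_absorb2)
  qed
  note restr = this
  show "M' = M"
  proof (rule measure_eqI)
    show "sets M' = sets M" using M M' by simp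
    fix X assume "X \<in> sets M'"
    hence "X \<in> sets unit_square" using M' by simp
    thus "emeasure M' X = emeasure M X"
      using restr[OF _ sp(2), of X] restr[OF M(2) sp(1), of X] M' unfolding same by simp
  qed
qed (use assms in auto)

lemma copula_measure_ev_copula: "pickands A \<Longrightarrow> copula_measure (ev_copula A) = ev_law A"
  by (intro copula_measure_eqI prob_space_ev_law measure_ev_law) (auto simp: ev_law_def)

section \<open>The integral formula for Kendall's tau\<close>

text \<open>
  The integrand of \<open>1 - \<tau>\<close>, which in terms of the derivative of \<open>A\<close> reads
  \<open>(1 + (1 - s) A'/A) (1 - s A'/A)\<close>.
\<close>

definition tau_density :: "(real \<Rightarrow> real) \<Rightarrow> real \<Rightarrow> real" where
  "tau_density A s = tangent_at_0 A s * tangent_at_1 A s / (A s)\<^sup>2"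

lemma measurable_tau_density:
  assumes "pickands A"
  shows "tau_density A \<in> borel_measurable unif"
proof -
  note [measurable] = measurable_pickands[OF assms]
  show ?thesis unfolding tau_density_def[abs_def] by measurable
qed

lemma tau_density_nonneg:
  assumes "pickands A" "s \<in> {0<..<1}"
  shows "0 \<le> tau_density A s"
  unfolding tau_density_def using tangent_at_0_bounds[OF assms] tangent_at_1_bounds[OF assms] by simp

lemma measurable_section:
  assumes "f \<in> borel_measurable (unif \<Otimes>\<^sub>M unif)" and "x \<in> {0<..<1}"
  shows "(\<lambda>s. f (x, s)) \<in> borel_measurable unif"
  by (rule measurable_compose[OF _ assms(1)]) (use assms(2) in simp)

text \<open>
  Integration by parts in probabilistic form: the value of the copula at the random point is the
  integral of \<open>curve_density A x\<close> up to the quantile, and \<open>s\<close> lies below the quantile exactly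
  with probability \<open>1 - cond_cdf A x s\<close>.
\<close>

lemma nn_integral_copula_section:
  assumes A: "pickands A" and x: "x \<in> {0<..<1}"
  shows "(\<integral>\<^sup>+w. ennreal (ev_copula A (fst (ev_pair A (x, w))) (snd (ev_pair A (x, w)))) \<partial>unif)
    = (\<integral>\<^sup>+s. ennreal (curve_density A x s * (1 - cond_cdf A x s)) \<partial>unif)"
proof -
  have [measurable]: "curve_density A x \<in> borel_measurable unif" "cond_cdf A x \<in> borel_measurable unif"
    using measurable_section[OF measurable_curve_density[OF A] x] measurable_section[OF measurable_cond_cdf[OF A] x]
    by simp_all
  \<comment> \<open>For the exchange of integrals, the condition \<open>s < quantile A x w\<close> is expressed by the jointly
    measurable condition \<open>cond_cdf A x s < w\<close>.\<close>
  define K :: "real \<Rightarrow> real \<Rightarrow> ennreal"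
    where "K w s = ennreal (curve_density A x s) * (if cond_cdf A x s < w then 1 else 0)" for w s
  have [measurable]: "case_prod K \<in> borel_measurable (unif \<Otimes>\<^sub>M unif)"
    unfolding K_def by measurable
  have "ennreal (ev_copula A (fst (ev_pair A (x, w))) (snd (ev_pair A (x, w)))) = (\<integral>\<^sup>+s. K w s \<partial>unif)"
    if w: "w \<in> {0<..<1}" for w
  proof -
    define S where "S = quantile A x w"
    have S: "S \<in> {0<..1}" unfolding S_def by (rule quantile_pos[OF A x w])
    have "ev_copula A (fst (ev_pair A (x, w))) (snd (ev_pair A (x, w))) = x powr (A S / S)"
      using ev_copula_curve[OF A x S] by (simp add: ev_pair_def S_def)
    hence "ennreal (ev_copula A (fst (ev_pair A (x, w))) (snd (ev_pair A (x, w))))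
        = (\<integral>\<^sup>+s. ennreal (curve_density A x s) * indicator {0<..<S} s \<partial>unif)"
      using nn_integral_curve_density[OF A x S] by simp
    also have "\<dots> = (\<integral>\<^sup>+s. K w s \<partial>unif)"
    proof (rule nn_integral_cong)
      fix s assume "s \<in> space unif"
      hence s: "s \<in> {0<..<1}" by simp
      hence "s < S \<longleftrightarrow> cond_cdf A x s < w"
        using quantile_le_iff[OF A x s, of w] by (auto simp: S_def not_le[symmetric])
      thus "ennreal (curve_density A x s) * indicator {0<..<S} s = K w s"
        using s by (auto simp: K_def)
    qed
    finally show ?thesis .
  qed
  hence "(\<integral>\<^sup>+w. ennreal (ev_copula A (fst (ev_pair A (x, w))) (snd (ev_pair A (x, w)))) \<partial>unif)
      = (\<integral>\<^sup>+w. \<integral>\<^sup>+s. K w s \<partial>unif \<partial>unif)"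
    by (intro nn_integral_cong) simp
  also have "\<dots> = (\<integral>\<^sup>+s. \<integral>\<^sup>+w. K w s \<partial>unif \<partial>unif)"
    by (rule unif_pair.Fubini'[symmetric]) measurable
  also have "\<dots> = (\<integral>\<^sup>+s. ennreal (curve_density A x s * (1 - cond_cdf A x s)) \<partial>unif)"
  proof (rule nn_integral_cong)
    fix s assume "s \<in> space unif"
    hence s: "s \<in> {0<..<1}" by simp
    note G = cond_cdf_bounds[OF A x s]
    have "(\<integral>\<^sup>+w. K w s \<partial>unif) = ennreal (curve_density A x s) * (\<integral>\<^sup>+w. (if cond_cdf A x s < w then 1 else 0) \<partial>unif)"
      unfolding K_def by (rule nn_integral_cmult) measurable
    also have "(\<integral>\<^sup>+w. (if cond_cdf A x s < w then 1 else 0) \<partial>unif) =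
        (\<integral>\<^sup>+w. indicator {w\<in>space unif. cond_cdf A x s < w} w \<partial>unif)"
      by (intro nn_integral_cong) simp
    also have "\<dots> = emeasure unif {w\<in>space unif. cond_cdf A x s < w}"
      by (rule nn_integral_indicator) measurable
    also have "\<dots> = ennreal (1 - cond_cdf A x s)"
      using emeasure_unif_Ioc(2)[OF G] by (simp only: space_unif)
    finally show "(\<integral>\<^sup>+w. K w s \<partial>unif) = ennreal (curve_density A x s * (1 - cond_cdf A x s))"
      using G curve_density_nonneg[OF A x s] by (simp add: ennreal_mult)
  qed
  finally show ?thesis .
qed

text \<open>
  The integrand is a constant times \<open>x powr (k - 1) * (- ln x)\<close> with \<open>k = 2 * A s / s\<close>, because both
  factors are powers of \<open>x\<close>.
\<close>

lemma nn_integral_density_cond_cdf: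
  assumes A: "pickands A" and s: "s \<in> {0<..<1}"
  shows "(\<integral>\<^sup>+x. ennreal (curve_density A x s * cond_cdf A x s) \<partial>unif) = ennreal (tau_density A s / 4)"
proof -
  define c where "c = tangent_at_0 A s * tangent_at_1 A s / s\<^sup>2"
  define k where "k = 2 * A s / s"
  have As: "0 < A s" using pickands_pos[OF A, of s] s by simp
  have c: "0 \<le> c" using tangent_at_0_bounds[OF A s] tangent_at_1_bounds[OF A s] by (simp add: c_def)
  have k: "0 < k" using As s by (simp add: k_def)
  have "curve_density A x s * cond_cdf A x s = c * (x powr (k - 1) * (- ln x))" if x: "x \<in> {0<..<1}" for x
  proof -
    have "x powr (A s / s) * x powr (A s / s - 1) = x powr (k - 1)"
      by (simp add: k_def flip: powr_add)
    hence "c * (x powr (k - 1) * (- ln x)) = c * (x powr (A s / s) * x powr (A s / s - 1) * (- ln x))" by simp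
    thus ?thesis by (auto simp: curve_density_def cond_cdf_def c_def)
  qed
  hence "(\<integral>\<^sup>+x. ennreal (curve_density A x s * cond_cdf A x s) \<partial>unif)
      = (\<integral>\<^sup>+x. ennreal c * ennreal (x powr (k - 1) * (- ln x)) \<partial>unif)"
    using c by (intro nn_integral_cong) (simp add: ennreal_mult' flip: ennreal_mult')
  also have "\<dots> = ennreal c * ennreal (1 / k\<^sup>2)"
    by (subst nn_integral_cmult, measurable) (simp only: nn_integral_powr_neg_ln[OF k])
  also have "\<dots> = ennreal (c * (1 / k\<^sup>2))" using c by (rule ennreal_mult'[symmetric])
  also have "c * (1 / k\<^sup>2) = tau_density A s / 4"
    using s As by (simp add: c_def k_def tau_density_def field_simps)
  finally show ?thesis .
qed

text \<open>
  By the previous two lemmas the expectation \<open>E\<close> of the copula plus a quarter of the integral of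
  \<open>tau_density\<close> is the double integral of \<open>curve_density\<close>. The inner integral of the latter is
  \<open>x powr A 1 = x\<close>, so the sum is \<open>1/2\<close> and \<open>\<tau> = 4 E - 1\<close> is one minus the integral. The inequality
  makes the real number under \<open>ennreal\<close> nonnegative, so that no information is lost in the
  equation.
\<close>

lemma kendall_tau_ev_copula:
  assumes A: "pickands A"
  shows "(\<integral>\<^sup>+s. ennreal (tau_density A s) \<partial>unif) = ennreal (1 - kendall_tau (ev_copula A))"
    and "kendall_tau (ev_copula A) \<le> 1"
proof -
  let ?C = "\<lambda>p. ev_copula A (fst p) (snd p)"
  note [measurable] = measurable_curve_density[OF A] measurable_cond_cdf[OF A] measurable_ev_pair[OF A]
    measurable_tau_density[OF A]
  have C[measurable]: "?C \<in> borel_measurable unit_square"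
    by (rule borel_measurable_continuous_on_restrict[OF continuous_on_ev_copula[OF A]])
  have C0: "0 \<le> ?C p" if "p \<in> {0..1} \<times> {0..1}" for p
  proof -
    have "0 \<le> fst p * snd p" "fst p \<in> {0..1}" "snd p \<in> {0..1}" using that by auto
    thus ?thesis using ev_copula_bounds(1)[OF A, of "fst p" "snd p"] by linarith
  qed
  define E where "E = (\<integral>\<^sup>+p. ennreal (?C p) \<partial>ev_law A)"
  define I where "I = (\<integral>\<^sup>+s. ennreal (tau_density A s) \<partial>unif)"
  have tau: "kendall_tau (ev_copula A) = - 1 + 4 * enn2real E"
    unfolding kendall_tau_def copula_measure_ev_copula[OF A] E_def
  proof (subst integral_eq_nn_integral)
    show "?C \<in> borel_measurable (ev_law A)" unfolding ev_law_def by simp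
    show "AE p in ev_law A. 0 \<le> ?C p"
      by (rule AE_I2) (use C0 in \<open>simp add: ev_law_def space_restrict_space\<close>)
  qed simp
  have "E = (\<integral>\<^sup>+p. ennreal (?C (ev_pair A p)) \<partial>(unif \<Otimes>\<^sub>M unif))"
    unfolding E_def ev_law_def by (subst nn_integral_distr) (auto intro!: measurable_ev_pair A)
  also have "\<dots> = (\<integral>\<^sup>+x. \<integral>\<^sup>+w. ennreal (?C (ev_pair A (x, w))) \<partial>unif \<partial>unif)"
    by (rule unif.nn_integral_fst[symmetric]) measurable
  also have "\<dots> = (\<integral>\<^sup>+x. \<integral>\<^sup>+s. ennreal (curve_density A x s * (1 - cond_cdf A x s)) \<partial>unif \<partial>unif)"
    by (intro nn_integral_cong nn_integral_copula_section A) simp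
  finally have E: "E = \<dots>" .
  define J where "J = (\<integral>\<^sup>+s. ennreal (tau_density A s / 4) \<partial>unif)"
  have "I = (\<integral>\<^sup>+s. ennreal 4 * ennreal (tau_density A s / 4) \<partial>unif)"
    unfolding I_def by (intro nn_integral_cong, subst ennreal_mult'[symmetric]) auto
  also have "\<dots> = ennreal 4 * J" unfolding J_def by (rule nn_integral_cmult) measurable
  finally have I: "I = ennreal 4 * J" .
  have "J = (\<integral>\<^sup>+s. \<integral>\<^sup>+x. ennreal (curve_density A x s * cond_cdf A x s) \<partial>unif \<partial>unif)"
    unfolding J_def by (intro nn_integral_cong nn_integral_density_cond_cdf[OF A, symmetric]) simp
  also have "\<dots> = (\<integral>\<^sup>+x. \<integral>\<^sup>+s. ennreal (curve_density A x s * cond_cdf A x s) \<partial>unif \<partial>unif)"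
    by (rule unif_pair.Fubini') (simp add: case_prod_unfold)
  finally have J: "J = \<dots>" .
  have "E + J = (\<integral>\<^sup>+x. (\<integral>\<^sup>+s. ennreal (curve_density A x s * (1 - cond_cdf A x s)) \<partial>unif)
      + (\<integral>\<^sup>+s. ennreal (curve_density A x s * cond_cdf A x s) \<partial>unif) \<partial>unif)"
    unfolding E J
    by (rule nn_integral_add[symmetric])
       (rule unif.borel_measurable_nn_integral, simp add: case_prod_unfold)+
  also have "\<dots> = (\<integral>\<^sup>+x. ennreal x \<partial>unif)"
  proof (rule nn_integral_cong)
    fix x assume "x \<in> space unif"
    hence x: "x \<in> {0<..<1}" by simp
    have [measurable]: "curve_density A x \<in> borel_measurable unif" "cond_cdf A x \<in> borel_measurable unif"
      using measurable_section[OF measurable_curve_density[OF A] x] measurable_section[OF measurable_cond_cdf[OF A] x]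
      by simp_all
    have "(\<integral>\<^sup>+s. ennreal (curve_density A x s * (1 - cond_cdf A x s)) \<partial>unif)
      + (\<integral>\<^sup>+s. ennreal (curve_density A x s * cond_cdf A x s) \<partial>unif)
      = (\<integral>\<^sup>+s. ennreal (curve_density A x s * (1 - cond_cdf A x s)) + ennreal (curve_density A x s * cond_cdf A x s) \<partial>unif)"
      by (rule nn_integral_add[symmetric]) measurable
    also have "\<dots> = (\<integral>\<^sup>+s. ennreal (curve_density A x s) * indicator {0<..<1} s \<partial>unif)"
    proof (rule nn_integral_cong)
      fix s assume "s \<in> space unif"
      hence s: "s \<in> {0<..<1}" by simp
      have "ennreal (curve_density A x s * (1 - cond_cdf A x s)) + ennreal (curve_density A x s * cond_cdf A x s)
          = ennreal (curve_density A x s * (1 - cond_cdf A x s) + curve_density A x s * cond_cdf A x s)"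
        using curve_density_nonneg[OF A x s] cond_cdf_bounds[OF A x s] by (intro ennreal_plus[symmetric]) simp_all
      also have "curve_density A x s * (1 - cond_cdf A x s) + curve_density A x s * cond_cdf A x s = curve_density A x s"
        by (simp add: algebra_simps)
      finally show "ennreal (curve_density A x s * (1 - cond_cdf A x s)) + ennreal (curve_density A x s * cond_cdf A x s)
          = ennreal (curve_density A x s) * indicator {0<..<1} s"
        using s by simp
    qed
    also have "\<dots> = ennreal (x powr (A 1 / 1))" by (rule nn_integral_curve_density[OF A x]) simp
    finally show "(\<integral>\<^sup>+s. ennreal (curve_density A x s * (1 - cond_cdf A x s)) \<partial>unif)
      + (\<integral>\<^sup>+s. ennreal (curve_density A x s * cond_cdf A x s) \<partial>unif) = ennreal x"
      using x pickands_ends[OF A] by simp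
  qed
  also have "\<dots> = ennreal (1 / 2)" by (rule nn_integral_unif_ident)
  finally have sum: "E + J = ennreal (1 / 2)" .
  have "E + J \<noteq> \<top>" unfolding sum by (rule ennreal_neq_top)
  hence fin: "E \<noteq> \<top>" "J \<noteq> \<top>" by auto
  obtain e where e: "E = ennreal e" "0 \<le> e" using fin(1) by (cases E) auto
  obtain j where j: "J = ennreal j" "0 \<le> j" using fin(2) by (cases J) auto
  have "ennreal (e + j) = ennreal (1 / 2)" using sum e j by (simp only: ennreal_plus)
  hence "e + j = 1 / 2" using e j by (subst (asm) ennreal_inj) auto
  moreover have "I = ennreal (4 * j)" using I j by (subst ennreal_mult') auto
  ultimately have i: "I = ennreal (1 - kendall_tau (ev_copula A))" "kendall_tau (ev_copula A) \<le> 1"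
    using tau e j by (auto simp: field_simps)
  thus "(\<integral>\<^sup>+s. ennreal (tau_density A s) \<partial>unif) = ennreal (1 - kendall_tau (ev_copula A))"
    "kendall_tau (ev_copula A) \<le> 1"
    using i by (simp_all add: I_def)
qed

section \<open>Bounding tau by one value of the dependence function\<close>

text \<open>
  The antiderivative is \<open>- (1 - s) / A s\<close>; in the mirrored statement below it is \<open>s / A s\<close>.
\<close>

lemma nn_integral_tangent_at_1:
  assumes A: "pickands A" and u: "u \<in> {0<..<1}"
  shows "(\<integral>\<^sup>+s. ennreal (tangent_at_1 A s / (A s)\<^sup>2) * indicator {0<..<u} s \<partial>unif) = ennreal (1 - (1 - u) / A u)"
proof -
  note [measurable] = measurable_pickands[OF A]
  have "(\<integral>\<^sup>+s. ennreal (tangent_at_1 A s / (A s)\<^sup>2) * indicator {0<..<u} s \<partial>unif)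
      = ennreal (- (1 - u) / A u - (- (1 - 0) / A 0))"
  proof (rule nn_integral_unif_FTC)
    show "countable (kinks A)" by (rule countable_kinks[OF A])
    have "continuous_on {0..u} A"
      by (rule continuous_on_subset[OF pickands_continuous_on[OF A]]) (use u in auto)
    moreover have "A s \<noteq> 0" if "s \<in> {0..u}" for s using pickands_pos[OF A, of s] that u by simp
    ultimately show "continuous_on {0..u} (\<lambda>s. - (1 - s) / A s)" by (intro continuous_intros) auto
    fix s assume "0 < s" "s < u"
    hence s: "s \<in> {0<..<1}" using u by auto
    have As: "A s > 0" using pickands_pos[OF A, of s] s by simp
    show "0 \<le> tangent_at_1 A s / (A s)\<^sup>2" using tangent_at_1_bounds[OF A s] by simp
    assume "s \<notin> kinks A"
    note dA = pickands_has_derivative'[OF A s this]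
    show "((\<lambda>s. - (1 - s) / A s) has_real_derivative tangent_at_1 A s / (A s)\<^sup>2) (at s)"
      using As by (auto intro!: derivative_eq_intros dA simp: tangent_at_1_def power2_eq_square field_simps)
  qed (use u in \<open>auto, measurable\<close>)
  also have "- (1 - u) / A u - (- (1 - 0) / A 0) = 1 - (1 - u) / A u"
    using pickands_ends[OF A] by (simp add: diff_divide_distrib)
  finally show ?thesis .
qed

lemma nn_integral_tangent_at_0:
  assumes A: "pickands A" and u: "u \<in> {0<..<1}"
  shows "(\<integral>\<^sup>+s. ennreal (tangent_at_0 A s / (A s)\<^sup>2) * indicator {u<..<1} s \<partial>unif) = ennreal (1 - u / A u)"
proof -
  note [measurable] = measurable_pickands[OF A]
  have "(\<integral>\<^sup>+s. ennreal (tangent_at_0 A s / (A s)\<^sup>2) * indicator {u<..<1} s \<partial>unif)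
      = ennreal (1 / A 1 - u / A u)"
  proof (rule nn_integral_unif_FTC)
    show "countable (kinks A)" by (rule countable_kinks[OF A])
    have "continuous_on {u..1} A"
      by (rule continuous_on_subset[OF pickands_continuous_on[OF A]]) (use u in auto)
    moreover have "A s \<noteq> 0" if "s \<in> {u..1}" for s using pickands_pos[OF A, of s] that u by simp
    ultimately show "continuous_on {u..1} (\<lambda>s. s / A s)" by (intro continuous_intros) auto
    fix s assume "u < s" "s < 1"
    hence s: "s \<in> {0<..<1}" using u by auto
    have As: "A s > 0" using pickands_pos[OF A, of s] s by simp
    show "0 \<le> tangent_at_0 A s / (A s)\<^sup>2" using tangent_at_0_bounds[OF A s] by simp
    assume "s \<notin> kinks A"
    note dA = pickands_has_derivative'[OF A s this]
    show "((\<lambda>s. s / A s) has_real_derivative tangent_at_0 A s / (A s)\<^sup>2) (at s)"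
      using As by (auto intro!: derivative_eq_intros dA simp: tangent_at_0_def power2_eq_square field_simps)
  qed (use u in \<open>auto, measurable\<close>)
  thus ?thesis using pickands_ends[OF A] by simp
qed

text \<open>
  Left of \<open>u\<close> the factor with \<open>tangent_at_1\<close> has an explicit antiderivative, right of \<open>u\<close> the one
  with \<open>tangent_at_0\<close>. The remaining factor is monotone and can be estimated.
\<close>

lemma nn_integral_tau_density_split:
  assumes A: "pickands A"
  shows "ennreal (1 - kendall_tau (ev_copula A)) =
     (\<integral>\<^sup>+s. ennreal (tangent_at_0 A s) * (ennreal (tangent_at_1 A s / (A s)\<^sup>2) * indicator {0<..<u} s) \<partial>unif)
   + (\<integral>\<^sup>+s. ennreal (tangent_at_1 A s) * (ennreal (tangent_at_0 A s / (A s)\<^sup>2) * indicator {u<..<1} s) \<partial>unif)"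
proof -
  note [measurable] = measurable_pickands[OF A]
  have td: "ennreal (tau_density A s) = ennreal (tangent_at_0 A s) * ennreal (tangent_at_1 A s / (A s)\<^sup>2)"
    "ennreal (tau_density A s) = ennreal (tangent_at_1 A s) * ennreal (tangent_at_0 A s / (A s)\<^sup>2)"
    if "s \<in> {0<..<1}" for s
    using tangent_at_0_bounds[OF A that] tangent_at_1_bounds[OF A that]
    by (simp_all add: tau_density_def mult.commute flip: ennreal_mult)
  have "ennreal (1 - kendall_tau (ev_copula A)) = (\<integral>\<^sup>+s. ennreal (tau_density A s) \<partial>unif)"
    using kendall_tau_ev_copula[OF A] by simp
  also have "\<dots> = (\<integral>\<^sup>+s. ennreal (tangent_at_0 A s) * (ennreal (tangent_at_1 A s / (A s)\<^sup>2) * indicator {0<..<u} s)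
     + ennreal (tangent_at_1 A s) * (ennreal (tangent_at_0 A s / (A s)\<^sup>2) * indicator {u<..<1} s) \<partial>unif)"
  proof (rule nn_integral_cong_AE)
    have eq: "ennreal (tau_density A s) =
       ennreal (tangent_at_0 A s) * (ennreal (tangent_at_1 A s / (A s)\<^sup>2) * indicator {0<..<u} s)
     + ennreal (tangent_at_1 A s) * (ennreal (tangent_at_0 A s / (A s)\<^sup>2) * indicator {u<..<1} s)"
      if s: "s \<in> {0<..<1}" "s \<noteq> u" for s
      using s td[OF s(1)] by (cases "s < u") simp_all
    have "AE s in unif. s \<in> {0<..<1}" using AE_space[of unif] by simp
    thus "AE s in unif. ennreal (tau_density A s) =
       ennreal (tangent_at_0 A s) * (ennreal (tangent_at_1 A s / (A s)\<^sup>2) * indicator {0<..<u} s)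
     + ennreal (tangent_at_1 A s) * (ennreal (tangent_at_0 A s / (A s)\<^sup>2) * indicator {u<..<1} s)"
      using AE_unif_neq[of u] by eventually_elim (rule eq)
  qed
  also have "\<dots> = (\<integral>\<^sup>+s. ennreal (tangent_at_0 A s) * (ennreal (tangent_at_1 A s / (A s)\<^sup>2) * indicator {0<..<u} s) \<partial>unif)
   + (\<integral>\<^sup>+s. ennreal (tangent_at_1 A s) * (ennreal (tangent_at_0 A s / (A s)\<^sup>2) * indicator {u<..<1} s) \<partial>unif)"
    by (rule nn_integral_add) measurable
  finally show ?thesis .
qed

lemma nn_integral_weighted_tangents:
  assumes A: "pickands A" and u: "u \<in> {0<..<1}" and pq: "0 \<le> p" "0 \<le> q"
  shows "(\<integral>\<^sup>+s. ennreal q * (ennreal (tangent_at_1 A s / (A s)\<^sup>2) * indicator {0<..<u} s) \<partial>unif)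
   + (\<integral>\<^sup>+s. ennreal p * (ennreal (tangent_at_0 A s / (A s)\<^sup>2) * indicator {u<..<1} s) \<partial>unif)
   = ennreal (q * (1 - (1 - u) / A u) + p * (1 - u / A u))"
proof -
  note [measurable] = measurable_pickands[OF A] measurable_unif_ident
  have "0 \<le> 1 - (1 - u) / A u" "0 \<le> 1 - u / A u"
    using pickands_pos[OF A, of u] pickands_bounds[OF A, of u] u by auto
  thus ?thesis using pq
    by (subst (1 2) nn_integral_cmult)
       (auto simp: nn_integral_tangent_at_0[OF A u] nn_integral_tangent_at_1[OF A u] ennreal_mult ennreal_plus)
qed

text \<open>
  Both tangent heights are at most \<open>1\<close>, since the tangent stays below \<open>A\<close>, which is \<open>1\<close> at
  both ends.
\<close>

lemma kendall_tau_ge_value: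
  assumes A: "pickands A" and u: "u \<in> {0<..<1}"
  shows "(1 - A u) / A u \<le> kendall_tau (ev_copula A)"
proof -
  have Au: "0 < A u" "A u \<le> 1" "u \<le> A u" "1 - u \<le> A u"
    using pickands_pos[OF A, of u] pickands_bounds[OF A, of u] u by auto
  have "ennreal (1 - kendall_tau (ev_copula A)) \<le>
     (\<integral>\<^sup>+s. ennreal 1 * (ennreal (tangent_at_1 A s / (A s)\<^sup>2) * indicator {0<..<u} s) \<partial>unif)
   + (\<integral>\<^sup>+s. ennreal 1 * (ennreal (tangent_at_0 A s / (A s)\<^sup>2) * indicator {u<..<1} s) \<partial>unif)"
    unfolding nn_integral_tau_density_split[OF A, of u]
    using tangent_at_0_bounds[OF A] tangent_at_1_bounds[OF A]
    by (intro add_mono nn_integral_mono mult_right_mono ennreal_leI) auto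
  also have "\<dots> = ennreal (1 * (1 - (1 - u) / A u) + 1 * (1 - u / A u))"
    by (rule nn_integral_weighted_tangents[OF A u]) auto
  also have "1 * (1 - (1 - u) / A u) + 1 * (1 - u / A u) = 1 - (1 - A u) / A u"
    using Au by (simp add: field_simps)
  finally have "1 - kendall_tau (ev_copula A) \<le> 1 - (1 - A u) / A u"
    using Au kendall_tau_ev_copula(2)[OF A] by (subst (asm) ennreal_le_iff) (auto simp: field_simps)
  thus ?thesis by simp
qed

text \<open>
  By monotonicity the tangent heights are at least those of the tangent at \<open>1/2\<close> on the
  halves in question. At \<open>u = 1/2\<close> both integrals have the same value \<open>1 - 1 / (2 * A (1/2))\<close>, and
  the two heights add up to \<open>2 * A (1/2)\<close> whatever the slope is.
\<close>

lemma kendall_tau_le_value_half: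
  assumes A: "pickands A"
  shows "kendall_tau (ev_copula A) \<le> 2 * (1 - A (1/2))"
proof -
  define m p q where "m = A (1/2)" and "p = tangent_at_1 A (1/2)" and "q = tangent_at_0 A (1/2)"
  have m: "0 < m" "1/2 \<le> m" using pickands_bounds[OF A, of "1/2"] by (auto simp: m_def)
  have pq: "0 \<le> p" "0 \<le> q" using tangent_at_0_bounds[OF A] tangent_at_1_bounds[OF A] by (auto simp: p_def q_def)
  have sum: "p + q = 2 * m" by (simp add: p_def q_def m_def tangent_at_0_def tangent_at_1_def)
  have "ennreal (q * (1 - (1 - 1/2) / A (1/2)) + p * (1 - (1/2) / A (1/2))) =
     (\<integral>\<^sup>+s. ennreal q * (ennreal (tangent_at_1 A s / (A s)\<^sup>2) * indicator {0<..<1/2} s) \<partial>unif)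
   + (\<integral>\<^sup>+s. ennreal p * (ennreal (tangent_at_0 A s / (A s)\<^sup>2) * indicator {1/2<..<1} s) \<partial>unif)"
    by (rule nn_integral_weighted_tangents[OF A _ pq, symmetric]) auto
  also have "\<dots> \<le> ennreal (1 - kendall_tau (ev_copula A))"
    unfolding nn_integral_tau_density_split[OF A, of "1/2"]
  proof (intro add_mono nn_integral_mono)
    fix s assume s: "s \<in> space unif"
    show "ennreal q * (ennreal (tangent_at_1 A s / (A s)\<^sup>2) * indicator {0<..<1/2} s)
       \<le> ennreal (tangent_at_0 A s) * (ennreal (tangent_at_1 A s / (A s)\<^sup>2) * indicator {0<..<1/2} s)"
      using s tangent_at_0_antimono[OF A, of s "1/2"]
      by (auto simp: q_def indicator_def intro!: mult_right_mono ennreal_leI)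
    show "ennreal p * (ennreal (tangent_at_0 A s / (A s)\<^sup>2) * indicator {1/2<..<1} s)
       \<le> ennreal (tangent_at_1 A s) * (ennreal (tangent_at_0 A s / (A s)\<^sup>2) * indicator {1/2<..<1} s)"
      using s tangent_at_1_mono[OF A, of "1/2" s]
      by (auto simp: p_def indicator_def intro!: mult_right_mono ennreal_leI)
  qed
  also have "q * (1 - (1 - 1/2) / A (1/2)) + p * (1 - (1/2) / A (1/2)) = (p + q) * (1 - 1 / (2 * m))"
    by (simp add: m_def algebra_simps add_divide_distrib)
  also have "\<dots> = 2 * m - 1" unfolding sum using m by (simp add: field_simps)
  finally have "2 * m - 1 \<le> 1 - kendall_tau (ev_copula A)"
    using m kendall_tau_ev_copula(2)[OF A] by (subst (asm) ennreal_le_iff) auto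
  thus ?thesis by (simp add: m_def)
qed

section \<open>Tent functions\<close>

text \<open>
  The piecewise linear function with value \<open>1\<close> at both ends and apex \<open>(u, v)\<close>; as an upper envelope
  of two lines its convexity is immediate.
\<close>

definition tent :: "real \<Rightarrow> real \<Rightarrow> real \<Rightarrow> real" where
  "tent u v s = max (1 - (1 - v) * s / u) (1 - (1 - v) * (1 - s) / (1 - u))"

lemma tent_left:
  assumes "u \<in> {0<..<1}" "v \<le> 1" "s \<le> u"
  shows "tent u v s = 1 - (1 - v) * s / u"
proof -
  have "s / u \<le> 1" "1 \<le> (1 - s) / (1 - u)" using assms by auto
  hence "s / u \<le> (1 - s) / (1 - u)" by linarith
  hence "(1 - v) * (s / u) \<le> (1 - v) * ((1 - s) / (1 - u))" using assms(2) by (intro mult_left_mono) auto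
  thus ?thesis by (simp add: tent_def)
qed

lemma tent_right:
  assumes "u \<in> {0<..<1}" "v \<le> 1" "u \<le> s"
  shows "tent u v s = 1 - (1 - v) * (1 - s) / (1 - u)"
proof -
  have "1 \<le> s / u" "(1 - s) / (1 - u) \<le> 1" using assms by auto
  hence "(1 - s) / (1 - u) \<le> s / u" by linarith
  hence "(1 - v) * ((1 - s) / (1 - u)) \<le> (1 - v) * (s / u)" using assms(2) by (intro mult_left_mono) auto
  thus ?thesis by (simp add: tent_def)
qed

lemma pickands_tent:
  assumes u: "u \<in> {0<..<1}" and v: "u \<le> v" "1 - u \<le> v" "v \<le> 1"
  shows "pickands (tent u v)"
  unfolding pickands_def
proof (intro conjI ballI)
  show "convex_on {0..1} (tent u v)"
  proof (rule convex_onI)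
    fix t x y :: real assume t: "0 < t" "t < 1"
    have affine: "1 - (1 - v) * ((1 - t) *\<^sub>R x + t *\<^sub>R y) / u =
        (1 - t) * (1 - (1 - v) * x / u) + t * (1 - (1 - v) * y / u)"
      "1 - (1 - v) * (1 - ((1 - t) *\<^sub>R x + t *\<^sub>R y)) / (1 - u) =
        (1 - t) * (1 - (1 - v) * (1 - x) / (1 - u)) + t * (1 - (1 - v) * (1 - y) / (1 - u))"
      by (simp_all add: algebra_simps add_divide_distrib diff_divide_distrib)
    show "tent u v ((1 - t) *\<^sub>R x + t *\<^sub>R y) \<le> (1 - t) * tent u v x + t * tent u v y"
      unfolding tent_def affine using t
      by (intro max.boundedI add_mono mult_left_mono max.cobounded1 max.cobounded2) auto
  qed (rule convex_real_interval(5))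
  fix s :: real assume s: "s \<in> {0..1}"
  have "(1 - v) * s / u \<ge> 0" "(1 - v) * (1 - s) / (1 - u) \<ge> 0" using u v s by auto
  thus "tent u v s \<le> 1" by (auto simp: tent_def)
  have "(1 - v) * s \<le> u * s" "(1 - v) * (1 - s) \<le> (1 - u) * (1 - s)"
    using u v s by (auto intro!: mult_right_mono)
  hence "(1 - v) * s / u \<le> s" "(1 - v) * (1 - s) / (1 - u) \<le> 1 - s"
    using u by (auto simp: pos_divide_le_eq mult.commute)
  thus "max s (1 - s) \<le> tent u v s" by (auto simp: tent_def)
qed

text \<open>
  For a tent the estimate in \<open>kendall_tau_ge_value\<close> with \<open>u\<close> at the apex is an equality: the tangents
  left of the apex all start at height \<open>1\<close> and those right of it all end at height \<open>1\<close>.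
\<close>

lemma kendall_tau_tent:
  assumes u: "u \<in> {0<..<1}" and v: "u \<le> v" "1 - u \<le> v" "v \<le> 1"
  shows "kendall_tau (ev_copula (tent u v)) = (1 - v) / v"
proof -
  define A where "A = tent u v"
  have A: "pickands A" unfolding A_def by (rule pickands_tent[OF assms])
  have Au: "A u = v" using u v by (simp add: A_def tent_left)
  have v0: "0 < v" using u v by simp
  have left: "tangent_at_0 A s = 1" if s: "0 < s" "s < u" for s
  proof -
    have s1: "s \<in> {0<..<1}" using s u by auto
    define c where "c = (1 - v) / u"
    have As: "A s = 1 - c * s" "v = 1 - c * u" using s u v by (auto simp: A_def tent_left c_def)
    have "A s + right_slope A s * (u - s) \<le> v" using right_slope_subgradient[OF A s1, of u] u Au by simp
    hence "(right_slope A s + c) * (u - s) \<le> 0" unfolding As by (simp add: algebra_simps)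
    hence "right_slope A s + c \<le> 0" using s by (simp add: mult_le_0_iff)
    hence "s * (right_slope A s + c) \<le> 0" using s by (simp add: mult_le_0_iff)
    hence "1 \<le> tangent_at_0 A s" unfolding tangent_at_0_def As(1) by (simp add: algebra_simps)
    thus ?thesis using tangent_at_0_bounds[OF A s1] by simp
  qed
  have right: "tangent_at_1 A s = 1" if s: "u < s" "s < 1" for s
  proof -
    have s1: "s \<in> {0<..<1}" using s u by auto
    define c where "c = (1 - v) / (1 - u)"
    have As: "A s = 1 - c * (1 - s)" "v = 1 - c * (1 - u)"
      using s u v by (auto simp: A_def tent_right c_def)
    have "A s + right_slope A s * (u - s) \<le> v" using right_slope_subgradient[OF A s1, of u] u Au by simp
    hence "0 \<le> (right_slope A s - c) * (s - u)" unfolding As by (simp add: algebra_simps)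
    hence "0 \<le> right_slope A s - c" using s by (simp add: zero_le_mult_iff)
    hence "0 \<le> (1 - s) * (right_slope A s - c)" using s by (simp add: zero_le_mult_iff)
    hence "1 \<le> tangent_at_1 A s" unfolding tangent_at_1_def As(1) by (simp add: algebra_simps)
    thus ?thesis using tangent_at_1_bounds[OF A s1] by simp
  qed
  have "ennreal (1 - kendall_tau (ev_copula A)) =
     (\<integral>\<^sup>+s. ennreal 1 * (ennreal (tangent_at_1 A s / (A s)\<^sup>2) * indicator {0<..<u} s) \<partial>unif)
   + (\<integral>\<^sup>+s. ennreal 1 * (ennreal (tangent_at_0 A s / (A s)\<^sup>2) * indicator {u<..<1} s) \<partial>unif)"
    unfolding nn_integral_tau_density_split[OF A, of u]
    by (intro arg_cong2[of _ _ _ _ "(+)"] nn_integral_cong) (auto simp: left right indicator_def)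
  also have "\<dots> = ennreal (1 * (1 - (1 - u) / A u) + 1 * (1 - u / A u))"
    by (rule nn_integral_weighted_tangents[OF A u]) auto
  also have "1 * (1 - (1 - u) / A u) + 1 * (1 - u / A u) = 1 - (1 - v) / v"
    using v0 by (simp add: Au field_simps)
  finally have "1 - kendall_tau (ev_copula A) = 1 - (1 - v) / v"
    using v u v0 kendall_tau_ev_copula(2)[OF A] by (subst (asm) ennreal_inj) (auto simp: field_simps)
  thus ?thesis by (simp add: A_def)
qed

section \<open>The sharp region\<close>

lemma lower_L_le_pickands:
  assumes A: "pickands A" and tau: "kendall_tau (ev_copula A) = \<tau>0" and "0 \<le> \<tau>0" and t: "t \<in> {0..1}"
  shows "lower_L (1 / (1 + \<tau>0)) t \<le> A t"
proof -
  have "1 / (1 + \<tau>0) \<le> A t"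
  proof (cases "t \<in> {0<..<1}")
    case True
    have "(1 - A t) / A t \<le> \<tau>0" using kendall_tau_ge_value[OF A True] tau by simp
    hence "1 \<le> A t * (1 + \<tau>0)"
      using pickands_pos[OF A t] by (simp add: pos_divide_le_eq algebra_simps)
    thus ?thesis using assms(3) by (simp add: pos_divide_le_eq)
  next
    case False
    hence "A t = 1" using t pickands_ends[OF A] by auto
    thus ?thesis using assms(3) by simp
  qed
  thus ?thesis using pickands_bounds[OF A t] by (auto simp: lower_L_def)
qed

text \<open>
  The bound on \<open>\<tau>\<close> gives the claim at \<open>1/2\<close>, and convexity carries it along the chords to the two
  end points.
\<close>

lemma pickands_le_upper_U:
  assumes A: "pickands A" and tau: "kendall_tau (ev_copula A) = \<tau>0" and t: "t \<in> {0..1}"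
  shows "A t \<le> upper_U \<tau>0 t"
proof -
  have half: "A (1/2) \<le> 1 - \<tau>0 / 2" using kendall_tau_le_value_half[OF A] tau by simp
  have cvx: "convex_on {0..1} A" using A by (simp add: pickands_def)
  show ?thesis
  proof (cases "t \<le> 1/2")
    case True
    have "A ((1 - 2 * t) *\<^sub>R 0 + (2 * t) *\<^sub>R (1/2)) \<le> (1 - 2 * t) * A 0 + 2 * t * A (1/2)"
      using True t by (intro convex_onD[OF cvx]) auto
    also have "\<dots> \<le> (1 - 2 * t) * 1 + 2 * t * (1 - \<tau>0 / 2)"
      using half True t pickands_ends[OF A] by (intro add_mono mult_left_mono) auto
    finally show ?thesis using True by (simp add: upper_U_def algebra_simps)
  next
    case False
    have "A ((1 - (2 - 2 * t)) *\<^sub>R 1 + (2 - 2 * t) *\<^sub>R (1/2)) \<le> (1 - (2 - 2 * t)) * A 1 + (2 - 2 * t) * A (1/2)"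
      using False t by (intro convex_onD[OF cvx]) auto
    also have "\<dots> \<le> (1 - (2 - 2 * t)) * 1 + (2 - 2 * t) * (1 - \<tau>0 / 2)"
      using half False t pickands_ends[OF A] by (intro add_mono mult_left_mono) auto
    finally show ?thesis using False by (simp add: upper_U_def algebra_simps)
  qed
qed

text \<open>
  Because \<open>(1 - b) / b = \<tau>0\<close>, an apex at height \<open>b\<close> is right in every horizontal position.
\<close>

lemma tent_in_pickands_tau:
  assumes \<tau>0: "\<tau>0 \<in> {0..1}" and b: "b = 1 / (1 + \<tau>0)" and u: "u \<in> {0<..<1}" "1 - b \<le> u" "u \<le> b"
  shows "tent u b \<in> pickands_tau \<tau>0"
proof -
  have b1: "b \<le> 1" "(1 - b) / b = \<tau>0" using \<tau>0 by (auto simp: b field_simps)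
  show ?thesis
    unfolding pickands_tau_def using pickands_tent[of u b] kendall_tau_tent[of u b] u b1 by simp
qed

text \<open>
  The line from \<open>(0, 1)\<close> through \<open>(t, y)\<close> reaches the height \<open>b\<close> at \<open>u = (1 - b) * t / (1 - y)\<close>. The
  lower bounds on \<open>y\<close> say that this happens at or to the right of \<open>t\<close> and of \<open>1 - b\<close>, and the upper
  bound says that it happens at or to the left of \<open>b\<close>.
\<close>

lemma exists_tent_through:
  fixes \<tau>0 b t y :: real
  assumes \<tau>0: "\<tau>0 \<in> {0..1}" and b: "b = 1 / (1 + \<tau>0)" and t: "t \<in> {0..1/2}"
    and y: "b \<le> y" "1 - t \<le> y" "y \<le> 1 - \<tau>0 * t"
  shows "\<exists>u\<in>{0<..<1}. 1 - b \<le> u \<and> u \<le> b \<and> t \<le> u \<and> 1 - (1 - b) * t / u = y"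
proof (cases "t = 0 \<or> y = 1")
  case True
  \<comment> \<open>Here \<open>y = 1\<close>, and either \<open>t = 0\<close>, where all tents have the value \<open>1\<close>, or \<open>b = 1\<close> and the
    tents are constant. Any admissible apex will do.\<close>
  have "1/2 \<le> b" using \<tau>0 by (simp add: b field_simps)
  moreover have "t = 0 \<or> \<tau>0 = 0" "y \<le> 1" using True y \<tau>0 t by (auto simp: mult_le_0_iff)
  ultimately show ?thesis using t y by (intro bexI[of _ "1/2"]) (auto simp: b)
next
  case False
  have y1: "y < 1" using False y \<tau>0 t by (smt (verit) atLeastAtMost_iff mult_nonneg_nonneg)
  have t0: "0 < t" using False t by simp
  have bt: "\<tau>0 * b = 1 - b" "0 < b" using \<tau>0 by (auto simp: b field_simps)
  have b1: "0 < 1 - b" using y y1 by simp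
  define u where "u = (1 - b) * t / (1 - y)"
  have "(1 - b) * (1 - y) \<le> (1 - b) * t" using b1 y by (intro mult_left_mono) auto
  hence u1: "1 - b \<le> u" using y1 by (simp add: u_def pos_le_divide_eq)
  have "(1 - y) * t \<le> (1 - b) * t" using t0 y by (intro mult_right_mono) auto
  hence u2: "t \<le> u" using y1 by (simp add: u_def pos_le_divide_eq mult.commute)
  have "b * (\<tau>0 * t) \<le> b * (1 - y)" using bt y by (intro mult_left_mono) auto
  moreover have "b * (\<tau>0 * t) = (1 - b) * t" unfolding bt(1)[symmetric] by simp
  ultimately have u3: "u \<le> b" using y1 by (simp add: u_def pos_divide_le_eq)
  have "1 - (1 - b) * t / u = y" using b1 t0 y1 by (simp add: u_def)
  thus ?thesis using u1 u2 u3 b1 by (intro bexI[of _ u]) auto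
qed

lemma Omega_tau_attained:
  assumes \<tau>0: "\<tau>0 \<in> {0..1}" and ty: "(t, y) \<in> Omega_tau \<tau>0"
  shows "\<exists>A\<in>pickands_tau \<tau>0. A t = y"
proof -
  define b where "b = 1 / (1 + \<tau>0)"
  have b: "1/2 \<le> b" "b \<le> 1" using \<tau>0 by (auto simp: b_def field_simps)
  have t: "t \<in> {0..1}" and low: "lower_L b t \<le> y" and up: "y \<le> upper_U \<tau>0 t"
    using ty by (auto simp: Omega_tau_def b_def)
  have y: "b \<le> y" "t \<le> y" "1 - t \<le> y" using low b by (auto simp: lower_L_def split: if_splits)
  show ?thesis
  proof (cases "t \<le> 1/2")
    case True
    then obtain u where u: "u \<in> {0<..<1}" "1 - b \<le> u" "u \<le> b" "t \<le> u" "1 - (1 - b) * t / u = y"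
      using exists_tent_through[OF \<tau>0 b_def, of t y] t y up by (auto simp: upper_U_def)
    have "tent u b t = y" using tent_left[of u b t] u b by simp
    thus ?thesis using tent_in_pickands_tau[OF \<tau>0 b_def u(1-3)] by blast
  next
    case False
    then obtain u where u: "u \<in> {0<..<1}" "1 - b \<le> u" "u \<le> b" "1 - t \<le> u" "1 - (1 - b) * (1 - t) / u = y"
      using exists_tent_through[OF \<tau>0 b_def, of "1 - t" y] t y up by (auto simp: upper_U_def)
    have "tent (1 - u) b t = y" using tent_right[of "1 - u" b t] u b by simp
    moreover have "tent (1 - u) b \<in> pickands_tau \<tau>0"
      by (rule tent_in_pickands_tau[OF \<tau>0 b_def]) (use u in auto)
    ultimately show ?thesis by blast
  qed
qed

theorem theorem3p4:
  fixes \<tau>0 b :: real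
  assumes "\<tau>0 \<in> {0..1}" and "b = 1 / (1 + \<tau>0)"
  shows "(\<forall>A\<in>pickands_tau \<tau>0. \<forall>t\<in>{0..1}. lower_L b t \<le> A t \<and> A t \<le> upper_U \<tau>0 t) \<and>
         (\<forall>(t, y)\<in>Omega_tau \<tau>0. \<exists>A\<in>pickands_tau \<tau>0. A t = y)"
  using lower_L_le_pickands pickands_le_upper_U Omega_tau_attained[OF assms(1)] assms
  by (auto simp: pickands_tau_def)

end
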